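(* Let $V$ be a finite set and let $\Pi_V$ be the set of coloured graphs with vertex set $V$ whose graph colouring is permutation-generated. Let $\mathcal{S}^{+}_{\Pi_V}=\{\mathcal{S}^{+}(\mathcal{V},\mathcal{E}) : (\mathcal{V},\mathcal{E})\in \Pi_V\}$ be the corresponding set of RCON models. Then $\mathcal{S}^{+}_{\Pi_V}$ is a complete non-distributive lattice with respect to model inclusion (set inclusion). Its meet operation is induced by the meet operation of $\langle\mathcal{C}_V;\preceq\rangle$: for $\mathcal{G},\mathcal{H}\in \Pi_V$, the meet of the models represented by $\mathcal{G}$ and $\mathcal{H}$ is the model represented by $\mathcal{G}\wedge\mathcal{H}$. The join of the models represented by $\mathcal{G},\mathcal{H}\in \Pi_V$ is the model represented by $s_{\Pi}(\mathcal{G}\vee\mathcal{H})$.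
   Context: Graphs are undirected and simple. A coloured graph with vertex set $V$ is a pair $\mathcal{G}=(\mathcal{V},\mathcal{E})$ where $\mathcal{V}$ is a partition of $V$ (vertex colour classes) and $\mathcal{E}$ is a partition of the edge set $E$ of some graph $G=(V,E)$ (edge colour classes); $G$ is the underlying uncoloured graph. $\mathcal{C}_V$ is the set of all coloured graphs with vertex set $V$. For partitions $P_1,P_2$ of the same set, $P_1\le P_2$ means $P_1$ is finer than $P_2$ (every set in $P_2$ is a union of sets in $P_1$); $\wedge,\vee$ for partitions are the infimum and supremum for this order. Partial order on $\mathcal{C}_V$: for $\mathcal{G}=(\mathcal{V}_{\mathcal{G}},\mathcal{E}_{\mathcal{G}})$ and $\mathcal{H}=(\mathcal{V}_{\mathcal{H}},\mathcal{E}_{\mathcal{H}})$ with edge sets $E_{\mathcal{G}},E_{\mathcal{H}}$, $\mathcal{G}\preceq\mathcal{H}$ iff (i) $E_{\mathcal{G}}\subseteq E_{\mathcal{H}}$, (ii) $\mathcal{V}_{\mathcal{G}}\ge\mathcal{V}_{\mathcal{H}}$, (iii) every class in $\mathcal{E}_{\mathcal{G}}$ is a union of classes in $\mathcal{E}_{\mathcal{H}}$. $\langle\mathcal{C}_V;\preceq\rangle$ is a complete lattice with $$\mathcal{G}\wedge\mathcal{H}=(\mathcal{V}_{\mathcal{G}}\vee\mathcal{V}_{\mathcal{H}},\ \mathcal{E}^{*}_{\mathcal{G}}\vee\mathcal{E}^{*}_{\mathcal{H}}),\qquad \mathcal{G}\vee\mathcal{H}=(\mathcal{V}_{\mathcal{G}}\wedge\mathcal{V}_{\mathcal{H}},\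 \mathcal{E}^{**}_{\mathcal{G}}\wedge\mathcal{E}^{**}_{\mathcal{H}}),$$ where $\mathcal{E}^{*}_{\mathcal{G}}\subseteq\mathcal{E}_{\mathcal{G}}$ and $\mathcal{E}^{*}_{\mathcal{H}}\subseteq\mathcal{E}_{\mathcal{H}}$ are maximal with the property that they are partitions of the same subset of $E_{\mathcal{G}}\cap E_{\mathcal{H}}$, $\mathcal{E}^{**}_{\mathcal{G}}=\mathcal{E}_{\mathcal{G}}\cup\{E_{\mathcal{H}}\setminus E_{\mathcal{G}}\}$ and $\mathcal{E}^{**}_{\mathcal{H}}=\mathcal{E}_{\mathcal{H}}\cup\{E_{\mathcal{G}}\setminus E_{\mathcal{H}}\}$ (empty sets omitted). For $(\mathcal{V},\mathcal{E})\in\mathcal{C}_V$, the RCON model represented by it is identified with the set $\mathcal{S}^{+}(\mathcal{V},\mathcal{E})$ of symmetric positive definite real matrices $K=(k_{\alpha\beta})_{\alpha,\beta\in V}$ such that $k_{\alpha\beta}=0$ for $\alpha\ne\beta$ with $\alpha\beta\notin E$, $k_{\alpha\alpha}=k_{\beta\beta}$ whenever $\alpha,\beta$ lie in the same class of $\mathcal{V}$, and $k_{\alpha\beta}=k_{\gamma\delta}$ whenever the edges $\alpha\beta,\gamma\delta$ lie in the same class of $\mathcal{E}$. $\mathcal{G}=(\mathcal{V},\mathcal{E})$ with underlying graph $G=(V,E)$ is permutation-generated if there is a group $\Gamma\subseteq\mathrm{Aut}(G)$ of permutations of $V$ (where $\mathrm{Aut}(G)$ is the automorphism group of $G$) such that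 $\mathcal{V}$ and $\mathcal{E}$ are the sets of orbits of $\Gamma$ in $V$ and in $E$ respectively. For $\mathcal{G}=(\mathcal{V},\mathcal{E})\in\mathcal{C}_V$, let $\mathrm{Aut}(\mathcal{V},\mathcal{E})$ be the largest group of permutations of $V$ leaving the colouring $(\mathcal{V},\mathcal{E})$ invariant, i.e. mapping every vertex colour class and every edge colour class onto itself; $s_{\Pi}(\mathcal{G})=(\mathcal{V}_{\mathrm{Aut}},\mathcal{E}_{\mathrm{Aut}})$ is the colouring of $G$ given by the orbits of $\mathrm{Aut}(\mathcal{V},\mathcal{E})$ in $V$ and $E$. A lattice is distributive if $a\vee(b\wedge c)=(a\vee b)\wedge(a\vee c)$ for all $a,b,c$, and non-distributive otherwise.
   Formalization: Non-distributivity is asserted only when V has at least three elements; for |V| ≤ 1 there is a single model and for |V| = 2 the lattice is the four-element Boolean lattice, which is distributive. All other claims hold for every finite V. *)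

theory Defs
  imports
    Complex_Main
    "HOL-Library.Disjoint_Sets"
    "HOL-Library.Ramsey"
    "HOL-Algebra.Complete_Lattice"
    "HOL-Algebra.Group_Action"
begin

section \<open>Coloured graphs\<close>

text \<open>
  A coloured graph is the pair of its vertex colour classes and its edge colour classes; an edge
  is a two-element set of vertices.  The edge set of the underlying graph is the union of the
  edge colour classes.
\<close>

type_synonym 'a cgraph = "'a set set \<times> 'a set set set"

definition edges :: "'a cgraph \<Rightarrow> 'a set set" where
  "edges G = \<Union>(snd G)"

definition coloured_graphs :: "'a set \<Rightarrow> 'a cgraph set" where
  "coloured_graphs V =
     {G. partition_on V (fst G) \<and> (\<exists>E. E \<subseteq> [V]\<^bsup>2\<^esup> \<and> partition_on E (snd G))}"

text \<open>\<open>refines V P Q\<close> says that \<open>P\<close> is the finer partition, so \<open>G\<close> has the coarser vertex colouring.\<close>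

definition cg_le :: "'a set \<Rightarrow> 'a cgraph \<Rightarrow> 'a cgraph \<Rightarrow> bool" where
  "cg_le V G H \<longleftrightarrow>
     edges G \<subseteq> edges H \<and>
     refines V (fst H) (fst G) \<and>
     (\<forall>C\<in>snd G. \<exists>S\<subseteq>snd H. C = \<Union>S)"

definition partition_order :: "'b set \<Rightarrow> 'b set set gorder" where
  "partition_order A = \<lparr>carrier = {P. partition_on A P}, eq = (=), le = refines A\<rparr>"

definition cg_order :: "'a set \<Rightarrow> 'a cgraph gorder" where
  "cg_order V = \<lparr>carrier = coloured_graphs V, eq = (=), le = cg_le V\<rparr>"

section \<open>Explicit lattice operations on coloured graphs\<close>

text \<open>
  The infimum and supremum in \<open>cg_order V\<close> exist and are given by the usual formulas in terms of
  infima and suprema of partitions.  For the infimum, \<open>P\<close> and \<open>Q\<close> are the maximal subsets of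
  the edge colourings of \<open>G\<close> and \<open>H\<close> that partition the same set of edges; for the supremum, each
  edge colouring is extended by one class consisting of the edges only present in the other graph.
\<close>

lemma complete_lattice_partition_order: "complete_lattice (partition_order A)"
proof -
  interpret partition_order: partial_order "partition_order A"
    by unfold_locales
      (auto simp: partition_order_def refines_refl dest: refines_asym refines_trans)
  show ?thesis
  proof (rule partition_order.complete_lattice_criterion1)
    have "partition_on A ({A} - {{}})"
      by (auto simp: partition_on_def disjoint_def)
    moreover from this have "refines A P ({A} - {{}})" if "partition_on A P" for P
      unfolding refines_def
    proof (intro conjI ballI)
      fix X assume "X \<in> P"
      then have "X \<subseteq> A" "X \<noteq> {}"
        using partition_onD1[OF that] partition_onD3[OF that] by auto
      then show "\<exists>Y\<in>{A} - {{}}. X \<subseteq> Y" by auto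
    qed (use that in auto)
    ultimately show "\<exists>g. greatest (partition_order A) g (carrier (partition_order A))"
      by (auto simp: partition_order_def greatest_def intro!: exI[of _ "{A} - {{}}"])
  next
    fix S assume S: "S \<subseteq> carrier (partition_order A)" "S \<noteq> {}"
    then have S': "\<And>P. P \<in> S \<Longrightarrow> partition_on A P"
      by (auto simp: partition_order_def)
    have "greatest (partition_order A) (common_refinement S) (Lower (partition_order A) S)"
      using partition_on_common_refinement[OF S' S(2)] refines_common_refinement[OF S']
        common_refinement_coarsest[OF S' _ _ S(2)]
      by (auto simp: greatest_def Lower_def partition_order_def S')
    then show "\<exists>i. greatest (partition_order A) i (Lower (partition_order A) S)" ..
  qed
qed

lemma partition_meet:
  assumes "partition_on A P" "partition_on A Q"
  shows "refines A (P \<sqinter>\<^bsub>partition_order A\<^esub> Q) P"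
    and "refines A (P \<sqinter>\<^bsub>partition_order A\<^esub> Q) Q"
    and "refines A R P \<Longrightarrow> refines A R Q \<Longrightarrow> refines A R (P \<sqinter>\<^bsub>partition_order A\<^esub> Q)"
proof -
  interpret partition_order: complete_lattice "partition_order A"
    by (rule complete_lattice_partition_order)
  show "refines A (P \<sqinter>\<^bsub>partition_order A\<^esub> Q) P"
    and "refines A (P \<sqinter>\<^bsub>partition_order A\<^esub> Q) Q"
    and "refines A R P \<Longrightarrow> refines A R Q \<Longrightarrow> refines A R (P \<sqinter>\<^bsub>partition_order A\<^esub> Q)"
    using assms partition_order.meet_left[of P Q] partition_order.meet_right[of P Q]
      partition_order.meet_le[where z = R and x = P and y = Q]
    by (auto simp: partition_order_def refines_def)
qed

lemma partition_join:
  assumes "partition_on A P" "partition_on A Q"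
  shows "refines A P (P \<squnion>\<^bsub>partition_order A\<^esub> Q)"
    and "refines A Q (P \<squnion>\<^bsub>partition_order A\<^esub> Q)"
    and "refines A P R \<Longrightarrow> refines A Q R \<Longrightarrow> refines A (P \<squnion>\<^bsub>partition_order A\<^esub> Q) R"
proof -
  interpret partition_order: complete_lattice "partition_order A"
    by (rule complete_lattice_partition_order)
  show "refines A P (P \<squnion>\<^bsub>partition_order A\<^esub> Q)"
    and "refines A Q (P \<squnion>\<^bsub>partition_order A\<^esub> Q)"
    and "refines A P R \<Longrightarrow> refines A Q R \<Longrightarrow> refines A (P \<squnion>\<^bsub>partition_order A\<^esub> Q) R"
    using assms partition_order.join_left[of P Q] partition_order.join_right[of P Q]
      partition_order.join_le[where z = R and x = P and y = Q]
    by (auto simp: partition_order_def refines_def)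
qed

lemma refines_unions:
  assumes "refines A P Q" "B \<in> Q"
  shows "\<exists>S\<subseteq>P. B = \<Union>S"
  using partition_onD1[OF refines_obtains_subset[OF assms]]
  by (intro exI[of _ "{X \<in> P. X \<subseteq> B}"]) simp

lemma unions_refines:
  assumes P: "partition_on A P" and Q: "partition_on A Q" and U: "\<And>B. B \<in> Q \<Longrightarrow> \<exists>S\<subseteq>P. B = \<Union>S"
  shows "refines A P Q"
  unfolding refines_def
proof (intro conjI ballI P Q)
  fix X assume X: "X \<in> P"
  with P have "X \<noteq> {}" "X \<subseteq> A"
    by (auto simp: partition_on_def)
  then obtain x where "x \<in> X" "x \<in> A" by blast
  then obtain B where B: "B \<in> Q" "x \<in> B"
    using Q by (auto simp: partition_on_def)
  then obtain S where S: "S \<subseteq> P" "B = \<Union>S" using U by blast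
  then obtain Y where "Y \<in> S" "x \<in> Y" using B by blast
  with P X S \<open>x \<in> X\<close> have "Y = X"
    by (auto simp: partition_on_def disjoint_def)
  with S B \<open>Y \<in> S\<close> show "\<exists>Y\<in>Q. X \<subseteq> Y" by blast
qed

lemma sub_partition: "partition_on A P \<Longrightarrow> S \<subseteq> P \<Longrightarrow> partition_on (\<Union>S) S"
  by (auto simp: partition_on_def disjoint_def)

lemma extend_partition:
  "partition_on A P \<Longrightarrow> B \<inter> A = {} \<Longrightarrow> partition_on (A \<union> B) (P \<union> ({B} - {{}}))"
  by (cases "B = {}") (auto simp: partition_on_def disjoint_def)

lemma coloured_graphsD:
  assumes "G \<in> coloured_graphs V"
  shows "partition_on V (fst G)" "partition_on (edges G) (snd G)" "edges G \<subseteq> [V]\<^bsup>2\<^esup>"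
  using assms by (auto simp: coloured_graphs_def edges_def partition_on_def)

lemma coloured_graphsI:
  "partition_on V P \<Longrightarrow> partition_on E Q \<Longrightarrow> E \<subseteq> [V]\<^bsup>2\<^esup> \<Longrightarrow> (P, Q) \<in> coloured_graphs V"
  by (auto simp: coloured_graphs_def)

lemma partial_order_cg_order: "partial_order (cg_order V)"
proof -
  have anti: "G = H"
    if "cg_le V G H" "cg_le V H G" "G \<in> coloured_graphs V" "H \<in> coloured_graphs V" for G H
  proof -
    from that have E: "edges G = edges H" by (auto simp: cg_le_def)
    have "refines (edges G) (snd G) (snd H)" "refines (edges G) (snd H) (snd G)"
      using that coloured_graphsD(2)[of G V] coloured_graphsD(2)[of H V] E
      by (auto intro!: unions_refines simp: cg_le_def)
    moreover have "refines V (fst G) (fst H)" "refines V (fst H) (fst G)"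
      using that by (auto simp: cg_le_def)
    ultimately show ?thesis by (metis prod.expand refines_asym)
  qed
  have trans: "cg_le V G K" if le: "cg_le V G H" "cg_le V H K" for G H K
    unfolding cg_le_def
  proof (intro conjI ballI)
    show "edges G \<subseteq> edges K" "refines V (fst K) (fst G)"
      using that by (auto simp: cg_le_def intro: refines_trans)
    fix C assume "C \<in> snd G"
    then obtain S where S: "S \<subseteq> snd H" "C = \<Union>S" using le by (auto simp: cg_le_def)
    have "C \<subseteq> \<Union>{D \<in> snd K. D \<subseteq> C}"
    proof
      fix e assume "e \<in> C"
      then obtain D where D: "D \<in> S" "e \<in> D" using S by auto
      then obtain T where "T \<subseteq> snd K" "D = \<Union>T" using S le unfolding cg_le_def by (meson subsetD)
      with D obtain F where F: "F \<in> T" "e \<in> F" "F \<in> snd K" by auto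
      moreover have "F \<subseteq> C" using F D S \<open>D = \<Union>T\<close> by auto
      ultimately show "e \<in> \<Union>{D \<in> snd K. D \<subseteq> C}" by auto
    qed
    then show "\<exists>S\<subseteq>snd K. C = \<Union>S"
      by (intro exI[of _ "{D \<in> snd K. D \<subseteq> C}"]) blast
  qed
  have refl: "cg_le V G G" if "G \<in> coloured_graphs V" for G
    unfolding cg_le_def using coloured_graphsD(1)[OF that]
    by (auto intro: refines_refl exI[of _ "{C}" for C])
  show ?thesis
    by unfold_locales (auto simp: cg_order_def refl dest: anti intro: trans)
qed

lemma cg_meetI:
  assumes "M \<in> coloured_graphs V" "cg_le V M G" "cg_le V M H"
    and "\<And>K. K \<in> coloured_graphs V \<Longrightarrow> cg_le V K G \<Longrightarrow> cg_le V K H \<Longrightarrow> cg_le V K M"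
    and "G \<in> coloured_graphs V" "H \<in> coloured_graphs V"
  shows "greatest (cg_order V) M (Lower (cg_order V) {G, H})" "G \<sqinter>\<^bsub>cg_order V\<^esub> H = M"
proof -
  show *: "greatest (cg_order V) M (Lower (cg_order V) {G, H})"
    using assms by (auto simp: greatest_def Lower_def cg_order_def simp del: split_paired_All)
  show "G \<sqinter>\<^bsub>cg_order V\<^esub> H = M"
    unfolding meet_def inf_def
    using partial_order.greatest_unique[OF partial_order_cg_order * ] *
    by (metis (no_types, lifting) someI_ex)
qed

lemma cg_joinI:
  assumes "M \<in> coloured_graphs V" "cg_le V G M" "cg_le V H M"
    and "\<And>K. K \<in> coloured_graphs V \<Longrightarrow> cg_le V G K \<Longrightarrow> cg_le V H K \<Longrightarrow> cg_le V M K"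
    and "G \<in> coloured_graphs V" "H \<in> coloured_graphs V"
  shows "least (cg_order V) M (Upper (cg_order V) {G, H})" "G \<squnion>\<^bsub>cg_order V\<^esub> H = M"
proof -
  show *: "least (cg_order V) M (Upper (cg_order V) {G, H})"
    using assms by (auto simp: least_def Upper_def cg_order_def simp del: split_paired_All)
  show "G \<squnion>\<^bsub>cg_order V\<^esub> H = M"
    unfolding join_def sup_def
    using partial_order.least_unique[OF partial_order_cg_order * ] *
    by (metis (no_types, lifting) someI_ex)
qed

lemma cg_meet_eq:
  assumes G: "G \<in> coloured_graphs V" and H: "H \<in> coloured_graphs V"
    and P: "P \<subseteq> snd G" and Q: "Q \<subseteq> snd H" and PQ: "\<Union>P = \<Union>Q"
    and maximal: "\<And>P' Q'. P' \<subseteq> snd G \<Longrightarrow> Q' \<subseteq> snd H \<Longrightarrow> \<Union>P' = \<Union>Q' \<Longrightarrow> P' \<subseteq> P \<and> Q' \<subseteq> Q"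
  defines "M \<equiv> (fst G \<squnion>\<^bsub>partition_order V\<^esub> fst H, P \<squnion>\<^bsub>partition_order (\<Union>P)\<^esub> Q)"
  shows "greatest (cg_order V) M (Lower (cg_order V) {G, H})" "G \<sqinter>\<^bsub>cg_order V\<^esub> H = M"
proof -
  note GD = coloured_graphsD[OF G] and HD = coloured_graphsD[OF H]
  have pP: "partition_on (\<Union>P) P" using sub_partition[OF GD(2) P] .
  have pQ: "partition_on (\<Union>P) Q" using sub_partition[OF HD(2) Q] PQ by simp
  note vj = partition_join[OF GD(1) HD(1)] and ej = partition_join[OF pP pQ]
  have pM: "partition_on V (fst M)" "partition_on (\<Union>P) (snd M)"
    using vj(1) ej(1) by (simp_all add: M_def refines_def)
  have eM: "edges M = \<Union>P" using pM(2) by (simp add: edges_def partition_on_def)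
  have PG: "\<Union>P \<subseteq> edges G"
    using P by (auto simp: edges_def)
  have QH: "\<Union>P \<subseteq> edges H"
    unfolding PQ using Q by (auto simp: edges_def)
  have 1: "M \<in> coloured_graphs V"
    using coloured_graphsI[OF pM] PG GD(3) by auto
  have 2: "cg_le V M G"
    unfolding cg_le_def eM
  proof (intro conjI ballI)
    show "\<Union>P \<subseteq> edges G" by (rule PG)
    show "refines V (fst G) (fst M)" using vj(1) by (simp add: M_def)
    fix C assume "C \<in> snd M"
    then show "\<exists>S\<subseteq>snd G. C = \<Union>S"
      using refines_unions[OF ej(1)] P unfolding M_def by (metis snd_conv subset_trans)
  qed
  have 3: "cg_le V M H"
    unfolding cg_le_def eM
  proof (intro conjI ballI)
    show "\<Union>P \<subseteq> edges H" by (rule QH)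
    show "refines V (fst H) (fst M)" using vj(2) by (simp add: M_def)
    fix C assume "C \<in> snd M"
    then show "\<exists>S\<subseteq>snd H. C = \<Union>S"
      using refines_unions[OF ej(2)] Q unfolding M_def by (metis snd_conv subset_trans)
  qed
  have 4: "cg_le V K M"
    if K: "K \<in> coloured_graphs V" and KG: "cg_le V K G" and KH: "cg_le V K H" for K
  proof -
    note KD = coloured_graphsD[OF K]
    let ?P = "{D \<in> snd G. D \<subseteq> edges K}" and ?Q = "{D \<in> snd H. D \<subseteq> edges K}"
    have uP: "\<Union>?P = edges K"
    proof
      show "edges K \<subseteq> \<Union>?P"
      proof
        fix e assume "e \<in> edges K"
        then obtain C where C: "C \<in> snd K" "e \<in> C" by (auto simp: edges_def)
        then obtain S where "S \<subseteq> snd G" "C = \<Union>S" using KG by (auto simp: cg_le_def)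
        moreover have "C \<subseteq> edges K" using C by (auto simp: edges_def)
        ultimately show "e \<in> \<Union>?P" using C by blast
      qed
    qed auto
    have uQ: "\<Union>?Q = edges K"
    proof
      show "edges K \<subseteq> \<Union>?Q"
      proof
        fix e assume "e \<in> edges K"
        then obtain C where C: "C \<in> snd K" "e \<in> C" by (auto simp: edges_def)
        then obtain S where "S \<subseteq> snd H" "C = \<Union>S" using KH by (auto simp: cg_le_def)
        moreover have "C \<subseteq> edges K" using C by (auto simp: edges_def)
        ultimately show "e \<in> \<Union>?Q" using C by blast
      qed
    qed auto
    have sub: "?P \<subseteq> P \<and> ?Q \<subseteq> Q"
      by (rule maximal) (use uP uQ in auto)
    then have KP: "edges K \<subseteq> \<Union>P" using uP by blast
    define N where "N = snd K \<union> ({\<Union>P - edges K} - {{}})"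
    have pN: "partition_on (\<Union>P) N"
      using extend_partition[OF KD(2), of "\<Union>P - edges K"] KP unfolding N_def
      by (simp add: Un_absorb1 Int_commute)
    have UP: "\<exists>S\<subseteq>P. B = \<Union>S" if "B \<in> N" for B
    proof (cases "B \<in> snd K")
      case True
      then obtain S where S: "S \<subseteq> snd G" "B = \<Union>S" using KG by (auto simp: cg_le_def)
      moreover have "B \<subseteq> edges K" using True by (auto simp: edges_def)
      ultimately have "S \<subseteq> ?P" by blast
      with sub have "S \<subseteq> P" by (meson subset_trans)
      with S(2) show ?thesis by (intro exI[of _ S]) simp
    next
      case False
      with that have B: "B = \<Union>P - \<Union>?P" by (auto simp: N_def uP)
      have "B = \<Union>(P - ?P)"
        unfolding B using sub by (intro diff_Union_pairwise_disjoint partition_onD2[OF pP]) simp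
      then show ?thesis by blast
    qed
    have UQ: "\<exists>S\<subseteq>Q. B = \<Union>S" if "B \<in> N" for B
    proof (cases "B \<in> snd K")
      case True
      then obtain S where S: "S \<subseteq> snd H" "B = \<Union>S" using KH by (auto simp: cg_le_def)
      moreover have "B \<subseteq> edges K" using True by (auto simp: edges_def)
      ultimately have "S \<subseteq> ?Q" by blast
      with sub have "S \<subseteq> Q" by (meson subset_trans)
      with S(2) show ?thesis by (intro exI[of _ S]) simp
    next
      case False
      with that have B: "B = \<Union>Q - \<Union>?Q" by (auto simp: N_def uQ PQ)
      have "B = \<Union>(Q - ?Q)"
        unfolding B using sub by (intro diff_Union_pairwise_disjoint partition_onD2[OF pQ]) simp
      then show ?thesis by blast
    qed
    have MN: "refines (\<Union>P) (snd M) N"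
      unfolding M_def snd_conv
      by (intro ej(3) unions_refines pP pQ pN UP UQ)
    have "\<forall>C\<in>snd K. \<exists>S\<subseteq>snd M. C = \<Union>S"
      by (intro ballI refines_unions[OF MN]) (simp add: N_def)
    moreover have "refines V (fst M) (fst K)"
      unfolding M_def fst_conv using KG KH by (intro vj(3)) (auto simp: cg_le_def)
    ultimately show ?thesis using KP by (simp add: cg_le_def eM)
  qed
  show "greatest (cg_order V) M (Lower (cg_order V) {G, H})" "G \<sqinter>\<^bsub>cg_order V\<^esub> H = M"
    using cg_meetI[OF 1 2 3 4 G H] by auto
qed

lemma cg_join_eq:
  assumes G: "G \<in> coloured_graphs V" and H: "H \<in> coloured_graphs V"
  defines "P \<equiv> snd G \<union> ({edges H - edges G} - {{}})"
    and "Q \<equiv> snd H \<union> ({edges G - edges H} - {{}})"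
  defines "M \<equiv> (fst G \<sqinter>\<^bsub>partition_order V\<^esub> fst H, P \<sqinter>\<^bsub>partition_order (edges G \<union> edges H)\<^esub> Q)"
  shows "least (cg_order V) M (Upper (cg_order V) {G, H})" "G \<squnion>\<^bsub>cg_order V\<^esub> H = M"
proof -
  note GD = coloured_graphsD[OF G] and HD = coloured_graphsD[OF H]
  let ?E = "edges G \<union> edges H"
  have pP: "partition_on ?E P"
    using extend_partition[OF GD(2), of "edges H - edges G"] by (simp add: P_def Int_commute)
  have pQ: "partition_on ?E Q"
    using extend_partition[OF HD(2), of "edges G - edges H"]
    by (simp add: Q_def Int_commute Un_commute)
  note vm = partition_meet[OF GD(1) HD(1)] and em = partition_meet[OF pP pQ]
  have pM: "partition_on V (fst M)" "partition_on ?E (snd M)"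
    using vm(1) em(1) by (simp_all add: M_def refines_def)
  have eM: "edges M = ?E" using pM(2) by (simp add: edges_def partition_on_def)
  have 1: "M \<in> coloured_graphs V"
    using coloured_graphsI[OF pM] GD(3) HD(3) by auto
  have 2: "cg_le V G M"
    unfolding cg_le_def eM unfolding M_def fst_conv snd_conv
    by (intro conjI ballI vm(1) refines_unions[OF em(1)]) (simp_all add: P_def)
  have 3: "cg_le V H M"
    unfolding cg_le_def eM unfolding M_def fst_conv snd_conv
    by (intro conjI ballI vm(2) refines_unions[OF em(2)]) (simp_all add: Q_def)
  have 4: "cg_le V M K"
    if K: "K \<in> coloured_graphs V" and GK: "cg_le V G K" and HK: "cg_le V H K" for K
  proof -
    note KD = coloured_graphsD[OF K]
    let ?R = "\<lambda>F. {D \<in> snd K. D \<subseteq> F}"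
    have uR: "\<Union>(?R (edges L)) = edges L" if le: "cg_le V L K" for L
    proof
      show "edges L \<subseteq> \<Union>(?R (edges L))"
      proof
        fix e assume "e \<in> edges L"
        then obtain C where C: "C \<in> snd L" "e \<in> C" by (auto simp: edges_def)
        then obtain S where "S \<subseteq> snd K" "C = \<Union>S" using le by (auto simp: cg_le_def)
        moreover have "C \<subseteq> edges L" using C by (auto simp: edges_def)
        ultimately show "e \<in> \<Union>(?R (edges L))" using C by blast
      qed
    qed auto
    have dR: "\<exists>S\<subseteq>?R ?E. edges L - edges L' = \<Union>S"
      if "cg_le V L K" "cg_le V L' K" "edges L \<subseteq> ?E" for L L'
    proof -
      have "edges L - edges L' = \<Union>(?R (edges L)) - \<Union>(?R (edges L'))"
        by (simp add: uR that)
      also have "\<dots> = \<Union>(?R (edges L) - ?R (edges L'))" (is "?l = ?r")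
      proof
        show "?l \<subseteq> ?r" by blast
        show "?r \<subseteq> ?l"
        proof
          fix e assume "e \<in> ?r"
          then obtain C where C: "C \<in> ?R (edges L)" "C \<notin> ?R (edges L')" "e \<in> C" by blast
          have False if "D \<in> ?R (edges L')" "e \<in> D" for D
            using that C disjointD[OF partition_onD2[OF KD(2)], of C D] by blast
          with C show "e \<in> ?l" by blast
        qed
      qed
      finally have "edges L - edges L' = ?r" .
      moreover have "?R (edges L) - ?R (edges L') \<subseteq> ?R ?E" using that(3) by blast
      ultimately show ?thesis by (intro exI[of _ "?R (edges L) - ?R (edges L')"] conjI)
    qed
    have cR: "\<exists>S\<subseteq>?R ?E. C = \<Union>S" if le: "cg_le V L K" "C \<in> snd L" "edges L \<subseteq> ?E" for L C
    proof -
      obtain S where S: "S \<subseteq> snd K" "C = \<Union>S" using le by (auto simp: cg_le_def)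
      moreover have "C \<subseteq> edges L" using that by (auto simp: edges_def)
      ultimately have "S \<subseteq> ?R ?E" using le(3) by blast
      with S(2) show ?thesis by (intro exI[of _ S]) simp
    qed
    have "\<Union>(?R ?E) = ?E"
      using uR[OF GK] uR[OF HK] by blast
    then have pR: "partition_on ?E (?R ?E)"
      using sub_partition[OF KD(2), of "?R ?E"] by auto
    have "refines ?E (?R ?E) P"
    proof (rule unions_refines[OF pR pP])
      fix B assume "B \<in> P"
      then consider "B \<in> snd G" | "B = edges H - edges G" by (auto simp: P_def)
      then show "\<exists>S\<subseteq>?R ?E. B = \<Union>S"
        by cases (use cR[OF GK, of B] dR[OF HK GK] in simp_all)
    qed
    moreover have "refines ?E (?R ?E) Q"
    proof (rule unions_refines[OF pR pQ])
      fix B assume "B \<in> Q"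
      then consider "B \<in> snd H" | "B = edges G - edges H" by (auto simp: Q_def)
      then show "\<exists>S\<subseteq>?R ?E. B = \<Union>S"
        by cases (use cR[OF HK, of B] dR[OF GK HK] in simp_all)
    qed
    ultimately have RM: "refines ?E (?R ?E) (snd M)"
      unfolding M_def snd_conv by (rule em(3))
    have "\<exists>S\<subseteq>snd K. C = \<Union>S" if "C \<in> snd M" for C
    proof -
      from refines_unions[OF RM that] obtain S where "S \<subseteq> ?R ?E" "C = \<Union>S" by blast
      moreover from this have "S \<subseteq> snd K" by blast
      ultimately show ?thesis by (intro exI[of _ S]) simp
    qed
    moreover have "refines V (fst K) (fst M)"
      unfolding M_def fst_conv using GK HK by (intro vm(3)) (auto simp: cg_le_def)
    moreover have "?E \<subseteq> edges K" using GK HK by (auto simp: cg_le_def)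
    ultimately show ?thesis by (simp add: cg_le_def eM)
  qed
  show "least (cg_order V) M (Upper (cg_order V) {G, H})" "G \<squnion>\<^bsub>cg_order V\<^esub> H = M"
    using cg_joinI[OF 1 2 3 4 G H] by auto
qed

section \<open>Permutations, orbits, permutation-generated colourings\<close>

definition graph_aut :: "'a set \<Rightarrow> 'a set set \<Rightarrow> ('a \<Rightarrow> 'a) set" where
  "graph_aut V E =
     {g \<in> carrier (BijGroup V). \<forall>\<alpha>\<in>V. \<forall>\<beta>\<in>V. {\<alpha>, \<beta>} \<in> E \<longleftrightarrow> {g \<alpha>, g \<beta>} \<in> E}"

definition orbit_colouring :: "'a set \<Rightarrow> ('a \<Rightarrow> 'a) set \<Rightarrow> 'a set set \<Rightarrow> 'a cgraph" where
  "orbit_colouring V \<Gamma> E =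
     (orbits ((BijGroup V)\<lparr>carrier := \<Gamma>\<rparr>) V (\<lambda>g \<alpha>. g \<alpha>),
      orbits ((BijGroup V)\<lparr>carrier := \<Gamma>\<rparr>) E (\<lambda>g e. g ` e))"

definition perm_generated :: "'a set \<Rightarrow> 'a cgraph \<Rightarrow> bool" where
  "perm_generated V G \<longleftrightarrow>
     (\<exists>\<Gamma>. subgroup \<Gamma> (BijGroup V) \<and> \<Gamma> \<subseteq> graph_aut V (edges G) \<and>
          G = orbit_colouring V \<Gamma> (edges G))"

definition perm_generated_graphs :: "'a set \<Rightarrow> 'a cgraph set" where
  "perm_generated_graphs V = {G \<in> coloured_graphs V. perm_generated V G}"

definition cg_aut :: "'a set \<Rightarrow> 'a cgraph \<Rightarrow> ('a \<Rightarrow> 'a) set" where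
  "cg_aut V G =
     {g \<in> carrier (BijGroup V).
        (\<forall>A\<in>fst G. g ` A = A) \<and> (\<forall>C\<in>snd G. (\<lambda>e. g ` e) ` C = C)}"

definition s_perm :: "'a set \<Rightarrow> 'a cgraph \<Rightarrow> 'a cgraph" where
  "s_perm V G = orbit_colouring V (cg_aut V G) (edges G)"

section \<open>RCON models\<close>

text \<open>
  A real matrix indexed by \<open>V\<close> is an extensional function on \<open>V \<times> V\<close>, so that matrices are
  determined by their entries and models can be compared as sets.
\<close>

definition sym_pos_def :: "'a set \<Rightarrow> ('a \<times> 'a \<Rightarrow> real) set" where
  "sym_pos_def V =
     {K \<in> V \<times> V \<rightarrow>\<^sub>E UNIV.
        (\<forall>\<alpha>\<in>V. \<forall>\<beta>\<in>V. K (\<alpha>, \<beta>) = K (\<beta>, \<alpha>)) \<and>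
        (\<forall>x. (\<exists>\<alpha>\<in>V. x \<alpha> \<noteq> 0) \<longrightarrow> (\<Sum>\<alpha>\<in>V. \<Sum>\<beta>\<in>V. x \<alpha> * K (\<alpha>, \<beta>) * x \<beta>) > 0)}"

definition rcon_model :: "'a set \<Rightarrow> 'a cgraph \<Rightarrow> ('a \<times> 'a \<Rightarrow> real) set" where
  "rcon_model V G =
     {K \<in> sym_pos_def V.
        (\<forall>\<alpha>\<in>V. \<forall>\<beta>\<in>V. \<alpha> \<noteq> \<beta> \<and> {\<alpha>, \<beta>} \<notin> edges G \<longrightarrow> K (\<alpha>, \<beta>) = 0) \<and>
        (\<forall>A\<in>fst G. \<forall>\<alpha>\<in>A. \<forall>\<beta>\<in>A. K (\<alpha>, \<alpha>) = K (\<beta>, \<beta>)) \<and>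
        (\<forall>C\<in>snd G. \<forall>\<alpha> \<beta> \<gamma> \<delta>. {\<alpha>, \<beta>} \<in> C \<and> {\<gamma>, \<delta>} \<in> C \<longrightarrow> K (\<alpha>, \<beta>) = K (\<gamma>, \<delta>))}"

text \<open>The set of models represented by permutation-generated coloured graphs, ordered by inclusion.\<close>

definition perm_model_order :: "'a set \<Rightarrow> ('a \<times> 'a \<Rightarrow> real) set gorder" where
  "perm_model_order V =
     \<lparr>carrier = rcon_model V ` perm_generated_graphs V, eq = (=), le = (\<subseteq>)\<rparr>"

definition distributive :: "('b, 'c) gorder_scheme \<Rightarrow> bool" where
  "distributive L \<longleftrightarrow>
     (\<forall>a\<in>carrier L. \<forall>b\<in>carrier L. \<forall>c\<in>carrier L.
        a \<squnion>\<^bsub>L\<^esub> (b \<sqinter>\<^bsub>L\<^esub> c) = (a \<squnion>\<^bsub>L\<^esub> b) \<sqinter>\<^bsub>L\<^esub> (a \<squnion>\<^bsub>L\<^esub> c))"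

end

theory Submission
  imports Defs
begin

text \<open>
  The model map \<open>rcon_model V\<close> is an order embedding of the coloured graphs: inclusion of models is
  tested on diagonally dominant matrices that single out one colour class.  Moreover, groups of
  permutations and coloured graphs are related by a Galois connection, so that \<open>s_perm V\<close> is a closure
  operator on the lattice of coloured graphs whose closed elements are the permutation-generated
  ones.  Closed elements are stable under meets, and their joins are closures of joins.
\<close>

section \<open>Orbits\<close>

text \<open>The Galois connection rests on one equivalence: for a group \<open>\<Gamma>\<close> of
  automorphisms of a graph with edge set \<open>E\<close>, a coloured graph \<open>F\<close> lies
  below the orbit colouring of \<open>\<Gamma>\<close> on \<open>E\<close> iff
  \<open>edges F\<close> is contained in \<open>E\<close> and \<open>\<Gamma>\<close> in
  \<open>cg_aut V F\<close>. A set is a union of orbits exactly when the group maps it onto itself,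
  so the unions of classes in \<open>cg_le\<close> become the invariance in \<open>cg_aut\<close>.
  Joins do need the closure. On the vertices 1, 2, 3, 4 take the edgeless graph with classes {1,2},
  {3}, {4} and the graph with the edges 1-3 and 2-4 in one class and vertex classes {1,2}, {3,4}.
  Both are permutation-generated, but their join keeps 1 and 2 in one class although only the
  identity preserves its colouring. The model map must reflect the order and not merely preserve it:
  bounds in the lattice of models are tested against other models, and reflection turns such a test
  into one between coloured graphs.\<close>

locale set_action = group G for G (structure) +
  fixes E :: "'b set" and \<phi> :: "'a \<Rightarrow> 'b \<Rightarrow> 'b"
  assumes closed: "g \<in> carrier G \<Longrightarrow> x \<in> E \<Longrightarrow> \<phi> g x \<in> E"
    and one_act: "x \<in> E \<Longrightarrow> \<phi> \<one> x = x"
    and mult_act: "g \<in> carrier G \<Longrightarrow> h \<in> carrier G \<Longrightarrow> x \<in> E \<Longrightarrow> \<phi> (g \<otimes> h) x = \<phi> g (\<phi> h x)"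
begin

lemma mem_orbit: "x \<in> E \<Longrightarrow> x \<in> orbit G \<phi> x"
  unfolding orbit_def using one_act one_closed by force

lemma act_inv:
  assumes "g \<in> carrier G" "x \<in> E"
  shows "\<phi> (inv g) (\<phi> g x) = x" "\<phi> g (\<phi> (inv g) x) = x"
  using assms mult_act[of "inv g" g x] mult_act[of g "inv g" x] by (simp_all add: one_act)

lemma orbit_act:
  assumes g: "g \<in> carrier G" and x: "x \<in> E"
  shows "orbit G \<phi> (\<phi> g x) = orbit G \<phi> x"
proof -
  have sub: "orbit G \<phi> (\<phi> g x) \<subseteq> orbit G \<phi> x" if "g \<in> carrier G" "x \<in> E" for g x
    using that by (auto simp: orbit_def) (metis m_closed mult_act)
  show ?thesis
    using sub[OF g x] sub[of "inv g" "\<phi> g x"] g x by (auto simp: act_inv closed)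
qed

lemma orbit_eqI: "x \<in> E \<Longrightarrow> y \<in> orbit G \<phi> x \<Longrightarrow> orbit G \<phi> y = orbit G \<phi> x"
  by (auto simp: orbit_def[of G \<phi> x] orbit_act)

lemma orbit_subset: "x \<in> E \<Longrightarrow> orbit G \<phi> x \<subseteq> E"
  by (auto simp: orbit_def closed)

lemma partition_on_orbits: "partition_on E (orbits G E \<phi>)"
proof (rule partition_onI)
  show "\<Union>(orbits G E \<phi>) = E"
    using orbit_subset mem_orbit by (auto simp: orbits_def)
  show "{} \<notin> orbits G E \<phi>"
    using mem_orbit by (auto simp: orbits_def)
  show "disjnt p q" if "p \<in> orbits G E \<phi>" "q \<in> orbits G E \<phi>" "p \<noteq> q" for p q
  proof (rule ccontr)
    assume "\<not> disjnt p q"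
    then obtain y where "y \<in> p" "y \<in> q" by (auto simp: disjnt_def)
    with that show False by (auto simp: orbits_def dest: orbit_eqI)
  qed
qed

text \<open>Orbits of points of an invariant set stay inside it and cover it. Conversely, a union of
  orbits is mapped into itself by each element, and applying the inverse improves this inclusion to
  equality.\<close>

lemma union_of_orbits_iff:
  assumes "A \<subseteq> E"
  shows "(\<exists>S\<subseteq>orbits G E \<phi>. A = \<Union>S) \<longleftrightarrow> (\<forall>g\<in>carrier G. \<phi> g ` A = A)" (is "?l \<longleftrightarrow> ?r")
proof
  assume ?l
  then obtain S where S: "S \<subseteq> orbits G E \<phi>" "A = \<Union>S" by blast
  have sub: "\<phi> g x \<in> A" if g: "g \<in> carrier G" and x: "x \<in> A" for g x
  proof -
    obtain X where X: "X \<in> S" "x \<in> X" using x S(2) by blast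
    then obtain y where y: "y \<in> E" "X = orbit G \<phi> y" using S(1) by (auto simp: orbits_def)
    then have "x \<in> E" "X = orbit G \<phi> x"
      using X(2) orbit_eqI[of y x] orbit_subset[of y] by auto
    then have "\<phi> g x \<in> X" using g by (auto simp: orbit_def)
    then show ?thesis using X(1) S(2) by blast
  qed
  show ?r
  proof
    fix g assume g: "g \<in> carrier G"
    have "x \<in> \<phi> g ` A" if "x \<in> A" for x
    proof (rule image_eqI)
      show "x = \<phi> g (\<phi> (inv g) x)" using act_inv(2)[OF g, of x] that assms by auto
      show "\<phi> (inv g) x \<in> A" using sub[of "inv g" x] g that by simp
    qed
    with sub[OF g] show "\<phi> g ` A = A" by auto
  qed
next
  assume r: ?r
  have "A = \<Union>(orbit G \<phi> ` A)"
  proof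
    show "A \<subseteq> \<Union>(orbit G \<phi> ` A)"
      using mem_orbit assms by auto
    show "\<Union>(orbit G \<phi> ` A) \<subseteq> A"
    proof
      fix y assume "y \<in> \<Union>(orbit G \<phi> ` A)"
      then obtain x g where "x \<in> A" "g \<in> carrier G" "y = \<phi> g x" by (auto simp: orbit_def)
      with r show "y \<in> A" by (metis imageI)
    qed
  qed
  moreover have "orbit G \<phi> ` A \<subseteq> orbits G E \<phi>" using assms by (auto simp: orbits_def)
  ultimately show ?l by (intro exI[of _ "orbit G \<phi> ` A"] conjI)
qed

end

section \<open>Permutation groups acting on vertices and on edges\<close>

lemma carrier_BijGroup: "g \<in> carrier (BijGroup V) \<longleftrightarrow> g \<in> extensional V \<and> bij_betw g V V"
  by (simp add: BijGroup_def Bij_def)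

lemma BijGroup_mult_apply:
  "g \<in> carrier (BijGroup V) \<Longrightarrow> h \<in> carrier (BijGroup V) \<Longrightarrow> x \<in> V \<Longrightarrow> (g \<otimes>\<^bsub>BijGroup V\<^esub> h) x = g (h x)"
  by (simp add: BijGroup_def compose_def)

lemma BijGroup_mult_image:
  "g \<in> carrier (BijGroup V) \<Longrightarrow> h \<in> carrier (BijGroup V) \<Longrightarrow> e \<subseteq> V \<Longrightarrow>
    (g \<otimes>\<^bsub>BijGroup V\<^esub> h) ` e = g ` h ` e"
  unfolding image_image by (rule image_cong) (auto simp: BijGroup_mult_apply)

lemma graph_aut_image:
  assumes "g \<in> graph_aut V E" "E \<subseteq> [V]\<^bsup>2\<^esup>" "e \<in> E"
  shows "g ` e \<in> E"
proof -
  obtain x y where "e = {x, y}" "x \<in> V" "y \<in> V" using assms by (blast elim: nsets2_E)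
  with assms show ?thesis by (auto simp: graph_aut_def)
qed

lemma set_action_vertices:
  assumes "subgroup \<Gamma> (BijGroup V)"
  shows "set_action ((BijGroup V)\<lparr>carrier := \<Gamma>\<rparr>) V (\<lambda>g \<alpha>. g \<alpha>)"
proof -
  have \<Gamma>: "g \<in> \<Gamma> \<Longrightarrow> g \<in> carrier (BijGroup V)" for g
    using assms by (rule subgroup.mem_carrier)
  interpret group "(BijGroup V)\<lparr>carrier := \<Gamma>\<rparr>"
    using assms by (rule subgroup.subgroup_is_group[OF _ group_BijGroup])
  show ?thesis
  proof
    show "(\<one>\<^bsub>BijGroup V\<lparr>carrier := \<Gamma>\<rparr>\<^esub>) x = x" if "x \<in> V" for x
      using that by (simp add: BijGroup_def)
  qed (auto simp: BijGroup_mult_apply \<Gamma> dest!: \<Gamma> simp: carrier_BijGroup bij_betw_apply)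
qed

text \<open>Automorphisms keep \<open>E\<close> stable. The map sending an edge to its image need
  not be extensional on \<open>E\<close>, so it need not belong to \<open>BijGroup E\<close>, as
  \<open>group_action\<close> would demand; hence the pointwise axioms of
  \<open>set_action\<close>.\<close>

lemma set_action_edges:
  assumes "subgroup \<Gamma> (BijGroup V)" "\<Gamma> \<subseteq> graph_aut V E" "E \<subseteq> [V]\<^bsup>2\<^esup>"
  shows "set_action ((BijGroup V)\<lparr>carrier := \<Gamma>\<rparr>) E (\<lambda>g e. g ` e)"
proof -
  have \<Gamma>: "g \<in> \<Gamma> \<Longrightarrow> g \<in> carrier (BijGroup V)" for g
    using assms(1) by (rule subgroup.mem_carrier)
  have V: "e \<in> E \<Longrightarrow> e \<subseteq> V" for e using assms(3) by (auto simp: nsets_def)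
  interpret group "(BijGroup V)\<lparr>carrier := \<Gamma>\<rparr>"
    using assms(1) by (rule subgroup.subgroup_is_group[OF _ group_BijGroup])
  show ?thesis
  proof
    show "(\<one>\<^bsub>BijGroup V\<lparr>carrier := \<Gamma>\<rparr>\<^esub>) ` e = e" if "e \<in> E" for e
      using V[OF that] by (auto simp: BijGroup_def image_iff subset_iff)
    show "g ` e \<in> E" if "g \<in> carrier (BijGroup V\<lparr>carrier := \<Gamma>\<rparr>)" "e \<in> E" for g e
      using that assms by (auto intro: graph_aut_image)
  qed (auto simp: BijGroup_mult_image \<Gamma> V)
qed

lemma orbit_colouring_coloured:
  assumes "subgroup \<Gamma> (BijGroup V)" "\<Gamma> \<subseteq> graph_aut V E" "E \<subseteq> [V]\<^bsup>2\<^esup>"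
  shows "orbit_colouring V \<Gamma> E \<in> coloured_graphs V" "edges (orbit_colouring V \<Gamma> E) = E"
proof -
  note V = set_action.partition_on_orbits[OF set_action_vertices[OF assms(1)]]
  note E = set_action.partition_on_orbits[OF set_action_edges[OF assms]]
  show "orbit_colouring V \<Gamma> E \<in> coloured_graphs V"
    unfolding orbit_colouring_def by (rule coloured_graphsI[OF V E assms(3)])
  show "edges (orbit_colouring V \<Gamma> E) = E"
    using partition_onD1[OF E] by (simp add: orbit_colouring_def edges_def)
qed

section \<open>The closure operator \<open>s_perm\<close>\<close>

text \<open>This is the Galois connection. Both colour conditions of \<open>cg_le\<close> are
  brought to the form "every class of \<open>F\<close> is a union of orbits" and then become
  invariance under \<open>\<Gamma>\<close>.\<close>

lemma cg_le_orbit_colouring_iff: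
  assumes F: "F \<in> coloured_graphs V"
    and \<Gamma>: "subgroup \<Gamma> (BijGroup V)" "\<Gamma> \<subseteq> graph_aut V E" "E \<subseteq> [V]\<^bsup>2\<^esup>"
  shows "cg_le V F (orbit_colouring V \<Gamma> E) \<longleftrightarrow> edges F \<subseteq> E \<and> \<Gamma> \<subseteq> cg_aut V F"
proof -
  interpret v: set_action "(BijGroup V)\<lparr>carrier := \<Gamma>\<rparr>" V "\<lambda>g \<alpha>. g \<alpha>"
    using \<Gamma>(1) by (rule set_action_vertices)
  interpret e: set_action "(BijGroup V)\<lparr>carrier := \<Gamma>\<rparr>" E "\<lambda>g e. g ` e"
    using \<Gamma> by (rule set_action_edges)
  note D = coloured_graphsD[OF F]
  let ?O = "orbit_colouring V \<Gamma> E"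
  have "refines V (fst ?O) (fst F) \<longleftrightarrow> (\<forall>A\<in>fst F. \<exists>S\<subseteq>fst ?O. A = \<Union>S)"
    using refines_unions[of V "fst ?O" "fst F"] unions_refines[of V "fst ?O" "fst F"]
      v.partition_on_orbits D(1)
    unfolding orbit_colouring_def fst_conv by blast
  also have "\<dots> \<longleftrightarrow> (\<forall>A\<in>fst F. \<forall>g\<in>\<Gamma>. g ` A = A)"
    using v.union_of_orbits_iff partition_onD1[OF D(1)]
    by (simp add: orbit_colouring_def Union_upper)
  finally have 1: "refines V (fst ?O) (fst F) \<longleftrightarrow> (\<forall>A\<in>fst F. \<forall>g\<in>\<Gamma>. g ` A = A)" .
  \<comment> \<open>An edge class can be compared with orbits on \<open>E\<close> only if it lies in
    \<open>E\<close>; \<open>conj_cong\<close> supplies this premise at the end from the first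
    clause of \<open>cg_le\<close>.\<close>
  have 2: "(\<forall>C\<in>snd F. \<exists>S\<subseteq>snd ?O. C = \<Union>S) \<longleftrightarrow> (\<forall>C\<in>snd F. \<forall>g\<in>\<Gamma>. (\<lambda>e. g ` e) ` C = C)"
    if "edges F \<subseteq> E"
  proof (rule ball_cong)
    fix C assume "C \<in> snd F"
    then have "C \<subseteq> E" using that by (auto simp: edges_def)
    then show "(\<exists>S\<subseteq>snd ?O. C = \<Union>S) \<longleftrightarrow> (\<forall>g\<in>\<Gamma>. (\<lambda>e. g ` e) ` C = C)"
      using e.union_of_orbits_iff[of C] by (simp add: orbit_colouring_def)
  qed simp
  have 3: "\<Gamma> \<subseteq> cg_aut V F \<longleftrightarrow>
    (\<forall>A\<in>fst F. \<forall>g\<in>\<Gamma>. g ` A = A) \<and> (\<forall>C\<in>snd F. \<forall>g\<in>\<Gamma>. (\<lambda>e. g ` e) ` C = C)"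
    (is "_ \<longleftrightarrow> ?r")
  proof -
    have "\<Gamma> \<subseteq> cg_aut V F \<longleftrightarrow> (\<forall>g\<in>\<Gamma>. g \<in> cg_aut V F)" by (rule subset_eq)
    also have "\<dots> \<longleftrightarrow> (\<forall>g\<in>\<Gamma>. (\<forall>A\<in>fst F. g ` A = A) \<and> (\<forall>C\<in>snd F. (\<lambda>e. g ` e) ` C = C))"
      using subgroup.mem_carrier[OF \<Gamma>(1)] by (intro ball_cong refl) (simp add: cg_aut_def)
    also have "\<dots> \<longleftrightarrow> ?r" by (simp only: ball_conj_distrib) meson
    finally show ?thesis .
  qed
  show ?thesis
    unfolding cg_le_def orbit_colouring_coloured(2)[OF \<Gamma>] 1 3 using 2 by (simp cong: conj_cong)
qed

text \<open>The second claim makes \<open>cg_aut V F\<close> admissible as \<open>\<Gamma>\<close>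
  in the connection: \<open>cg_aut\<close> does not mention automorphisms of the underlying graph,
  but invariance of each edge class together with injectivity on \<open>V\<close> yields
  them.\<close>

lemma cg_aut_subgroup:
  assumes F: "F \<in> coloured_graphs V"
  shows "subgroup (cg_aut V F) (BijGroup V)" "cg_aut V F \<subseteq> graph_aut V (edges F)"
proof -
  note D = coloured_graphsD[OF F]
  have A: "A \<in> fst F \<Longrightarrow> A \<subseteq> V" for A
    using partition_onD1[OF D(1)] by auto
  have C: "C \<in> snd F \<Longrightarrow> e \<in> C \<Longrightarrow> e \<subseteq> V" for C e
    using D(3) by (auto simp: edges_def nsets_def)
  interpret group "BijGroup V" by (rule group_BijGroup)
  have one: "\<one>\<^bsub>BijGroup V\<^esub> x = x" if "x \<in> V" for x
    using that by (simp add: BijGroup_def)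
  have one_image: "\<one>\<^bsub>BijGroup V\<^esub> ` B = B" if "B \<subseteq> V" for B
    using that one by (force simp: image_iff)
  have inv_image: "(inv\<^bsub>BijGroup V\<^esub> g) ` g ` B = B" if "g \<in> carrier (BijGroup V)" "B \<subseteq> V" for g B
    using that BijGroup_mult_image[of "inv\<^bsub>BijGroup V\<^esub> g" V g B] by (simp add: one_image)
  show "subgroup (cg_aut V F) (BijGroup V)"
  proof (rule subgroupI)
    have "\<one>\<^bsub>BijGroup V\<^esub> \<in> cg_aut V F"
      using A C by (auto simp: cg_aut_def one_image)
    then show "cg_aut V F \<noteq> {}" by blast
  next
    fix g assume g: "g \<in> cg_aut V F"
    then have gc: "g \<in> carrier (BijGroup V)" by (simp add: cg_aut_def)
    show "inv\<^bsub>BijGroup V\<^esub> g \<in> cg_aut V F"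
      unfolding cg_aut_def
    proof (intro CollectI conjI ballI)
      show "inv\<^bsub>BijGroup V\<^esub> g \<in> carrier (BijGroup V)" using gc by simp
      show "(inv\<^bsub>BijGroup V\<^esub> g) ` X = X" if "X \<in> fst F" for X
        using inv_image[OF gc A[OF that]] g that by (simp add: cg_aut_def)
      show "(\<lambda>e. (inv\<^bsub>BijGroup V\<^esub> g) ` e) ` X = X" if X: "X \<in> snd F" for X
      proof -
        have "(\<lambda>e. (inv\<^bsub>BijGroup V\<^esub> g) ` e) ` (\<lambda>e. g ` e) ` X = (\<lambda>e. e) ` X"
          unfolding image_image[of "\<lambda>e. (inv\<^bsub>BijGroup V\<^esub> g) ` e" "\<lambda>e. g ` e"]
          using inv_image[OF gc C[OF X]] by (rule image_cong[OF refl])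
        with g X show ?thesis by (simp add: cg_aut_def)
      qed
    qed
  next
    fix g h assume gh: "g \<in> cg_aut V F" "h \<in> cg_aut V F"
    then have c: "g \<in> carrier (BijGroup V)" "h \<in> carrier (BijGroup V)" by (simp_all add: cg_aut_def)
    show "g \<otimes>\<^bsub>BijGroup V\<^esub> h \<in> cg_aut V F"
      unfolding cg_aut_def
    proof (intro CollectI conjI ballI)
      show "g \<otimes>\<^bsub>BijGroup V\<^esub> h \<in> carrier (BijGroup V)" using c by simp
      show "(g \<otimes>\<^bsub>BijGroup V\<^esub> h) ` X = X" if "X \<in> fst F" for X
        using BijGroup_mult_image[OF c A[OF that]] gh that by (simp add: cg_aut_def)
      show "(\<lambda>e. (g \<otimes>\<^bsub>BijGroup V\<^esub> h) ` e) ` X = X" if X: "X \<in> snd F" for X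
      proof -
        have "(\<lambda>e. (g \<otimes>\<^bsub>BijGroup V\<^esub> h) ` e) ` X = (\<lambda>e. g ` e) ` (\<lambda>e. h ` e) ` X"
          unfolding image_image[of "\<lambda>e. g ` e" "\<lambda>e. h ` e"]
          using BijGroup_mult_image[OF c C[OF X]] by (rule image_cong[OF refl])
        with gh X show ?thesis by (simp add: cg_aut_def)
      qed
    qed
  qed (auto simp: cg_aut_def)
  show "cg_aut V F \<subseteq> graph_aut V (edges F)"
  proof
    fix g assume g: "g \<in> cg_aut V F"
    then have image: "X \<in> snd F \<Longrightarrow> (\<lambda>e. g ` e) ` X = X" for X by (simp add: cg_aut_def)
    have inj: "inj_on g V" using g by (auto simp: cg_aut_def carrier_BijGroup bij_betw_def)
    have "{x, y} \<in> edges F \<longleftrightarrow> {g x, g y} \<in> edges F" if xy: "x \<in> V" "y \<in> V" for x y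
    proof
      assume "{x, y} \<in> edges F"
      then obtain X where X: "X \<in> snd F" "{x, y} \<in> X" by (auto simp: edges_def)
      then have "g ` {x, y} \<in> X" using imageI[OF X(2), of "\<lambda>e. g ` e"] image by simp
      with X show "{g x, g y} \<in> edges F" by (auto simp: edges_def)
    next
      assume "{g x, g y} \<in> edges F"
      then obtain X where X: "X \<in> snd F" "g ` {x, y} \<in> X" by (auto simp: edges_def)
      \<comment> \<open>Being mapped onto itself, the class contains a preimage of this edge;
        injectivity of \<open>g\<close> identifies that preimage with {x, y}.\<close>
      then obtain e where e: "e \<in> X" "g ` {x, y} = g ` e"
        using image[OF X(1)] by (metis imageE)
      then have "{x, y} = e"
        using inj_on_image_eq_iff[OF inj, of "{x, y}" e] C[OF X(1)] xy by auto
      with e X show "{x, y} \<in> edges F" by (auto simp: edges_def)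
    qed
    with g show "g \<in> graph_aut V (edges F)" by (simp add: graph_aut_def cg_aut_def)
  qed
qed

lemma cg_le_refl: "G \<in> coloured_graphs V \<Longrightarrow> cg_le V G G"
  and cg_le_antisym: "cg_le V G H \<Longrightarrow> cg_le V H G \<Longrightarrow>
    G \<in> coloured_graphs V \<Longrightarrow> H \<in> coloured_graphs V \<Longrightarrow> G = H"
  and cg_le_trans: "cg_le V G H \<Longrightarrow> cg_le V H K \<Longrightarrow>
    G \<in> coloured_graphs V \<Longrightarrow> H \<in> coloured_graphs V \<Longrightarrow> K \<in> coloured_graphs V \<Longrightarrow> cg_le V G K"
proof -
  interpret partial_order "cg_order V" by (rule partial_order_cg_order)
  show "G \<in> coloured_graphs V \<Longrightarrow> cg_le V G G"
    using le_refl[of G] by (simp add: cg_order_def)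
  show "cg_le V G H \<Longrightarrow> cg_le V H G \<Longrightarrow> G \<in> coloured_graphs V \<Longrightarrow> H \<in> coloured_graphs V \<Longrightarrow> G = H"
    using le_antisym[of G H] by (simp add: cg_order_def)
  show "cg_le V G H \<Longrightarrow> cg_le V H K \<Longrightarrow>
    G \<in> coloured_graphs V \<Longrightarrow> H \<in> coloured_graphs V \<Longrightarrow> K \<in> coloured_graphs V \<Longrightarrow> cg_le V G K"
    using le_trans[of G H K] by (simp add: cg_order_def)
qed

lemma perm_generatedE:
  assumes "P \<in> perm_generated_graphs V"
  obtains \<Gamma> where "subgroup \<Gamma> (BijGroup V)" "\<Gamma> \<subseteq> graph_aut V (edges P)" "edges P \<subseteq> [V]\<^bsup>2\<^esup>"
    "P = orbit_colouring V \<Gamma> (edges P)"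
  using assms by (auto simp: perm_generated_graphs_def perm_generated_def dest: coloured_graphsD)

lemma perm_generated_coloured: "P \<in> perm_generated_graphs V \<Longrightarrow> P \<in> coloured_graphs V"
  by (simp add: perm_generated_graphs_def)

lemma s_perm_perm_generated:
  assumes "F \<in> coloured_graphs V"
  shows "s_perm V F \<in> perm_generated_graphs V" "edges (s_perm V F) = edges F"
proof -
  note D = cg_aut_subgroup[OF assms] coloured_graphsD(3)[OF assms]
  note O = orbit_colouring_coloured[OF D, folded s_perm_def]
  show "edges (s_perm V F) = edges F" by (rule O)
  then show "s_perm V F \<in> perm_generated_graphs V"
    using O(1) D s_perm_def[of V F]
    by (auto simp: perm_generated_graphs_def perm_generated_def)
qed

text \<open>The connection at \<open>\<Gamma> = cg_aut V F\<close> and \<open>E = edges F\<close>,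
  where its right-hand side is trivial.\<close>

lemma s_perm_above:
  assumes "F \<in> coloured_graphs V"
  shows "cg_le V F (s_perm V F)"
  unfolding s_perm_def
  using cg_le_orbit_colouring_iff[OF assms cg_aut_subgroup[OF assms] coloured_graphsD(3)[OF assms]]
  by simp

text \<open>If \<open>\<Gamma>\<close> generates \<open>P\<close>, then \<open>F\<close> below
  \<open>P\<close> puts \<open>\<Gamma>\<close> inside \<open>cg_aut V F\<close>. That group also
  preserves the orbit colouring it defines, so the connection can be read backwards for
  \<open>s_perm V F\<close>.\<close>

lemma s_perm_least:
  assumes F: "F \<in> coloured_graphs V" and P: "P \<in> perm_generated_graphs V" and le: "cg_le V F P"
  shows "cg_le V (s_perm V F) P"
proof -
  obtain \<Gamma> where \<Gamma>: "subgroup \<Gamma> (BijGroup V)" "\<Gamma> \<subseteq> graph_aut V (edges P)" "edges P \<subseteq> [V]\<^bsup>2\<^esup>"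
    "P = orbit_colouring V \<Gamma> (edges P)"
    using P by (rule perm_generatedE)
  note aut = cg_aut_subgroup[OF F] coloured_graphsD(3)[OF F]
  have s: "s_perm V F \<in> coloured_graphs V"
    using s_perm_perm_generated(1)[OF F] by (rule perm_generated_coloured)
  have "edges F \<subseteq> edges P" "\<Gamma> \<subseteq> cg_aut V F"
    using cg_le_orbit_colouring_iff[OF F \<Gamma>(1-3)] le \<Gamma>(4) by auto
  \<comment> \<open>The connection applied to the reflexive inequality of \<open>s_perm V F\<close>
    with itself.\<close>
  moreover have "cg_aut V F \<subseteq> cg_aut V (s_perm V F)"
    using cg_le_orbit_colouring_iff[OF s aut] cg_le_refl[OF s] by (simp add: s_perm_def)
  ultimately show ?thesis
    using cg_le_orbit_colouring_iff[OF s \<Gamma>(1-3)] \<Gamma>(4) s_perm_perm_generated(2)[OF F] by auto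
qed

text \<open>The opposite inequality always holds, so \<open>F\<close> coincides with its
  closure.\<close>

lemma perm_generatedI:
  assumes "F \<in> coloured_graphs V" "cg_le V (s_perm V F) F"
  shows "F \<in> perm_generated_graphs V"
  using cg_le_antisym[OF assms(2) s_perm_above[OF assms(1)]] s_perm_perm_generated(1)[OF assms(1)]
    assms(1) perm_generated_coloured by metis

text \<open>The explicit formula presupposes maximal sub-colourings. They exist because pairs of
  subfamilies covering the same edges are closed under componentwise unions, so the union over all
  such pairs is the largest one.\<close>

lemma cg_meet:
  assumes G: "G \<in> coloured_graphs V" and H: "H \<in> coloured_graphs V"
  shows "G \<sqinter>\<^bsub>cg_order V\<^esub> H \<in> coloured_graphs V"
    and "cg_le V (G \<sqinter>\<^bsub>cg_order V\<^esub> H) G" "cg_le V (G \<sqinter>\<^bsub>cg_order V\<^esub> H) H"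
    and "K \<in> coloured_graphs V \<Longrightarrow> cg_le V K G \<Longrightarrow> cg_le V K H \<Longrightarrow> cg_le V K (G \<sqinter>\<^bsub>cg_order V\<^esub> H)"
proof -
  define R where "R = {(P, Q). P \<subseteq> snd G \<and> Q \<subseteq> snd H \<and> \<Union>P = \<Union>Q}"
  define P Q where "P = (\<Union>X\<in>R. fst X)" and "Q = (\<Union>X\<in>R. snd X)"
  have sub: "P \<subseteq> snd G" "Q \<subseteq> snd H" by (auto simp: P_def Q_def R_def)
  have "\<Union>P = (\<Union>X\<in>R. \<Union>(fst X))" by (auto simp: P_def)
  also have "\<dots> = (\<Union>X\<in>R. \<Union>(snd X))" by (rule SUP_cong) (clarsimp simp: R_def)+
  also have "\<dots> = \<Union>Q" by (auto simp: Q_def)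
  finally have eq: "\<Union>P = \<Union>Q" .
  have max: "P' \<subseteq> P \<and> Q' \<subseteq> Q" if "P' \<subseteq> snd G" "Q' \<subseteq> snd H" "\<Union>P' = \<Union>Q'" for P' Q'
  proof -
    have "(P', Q') \<in> R" using that by (simp add: R_def)
    then show ?thesis by (force simp: P_def Q_def)
  qed
  have "greatest (cg_order V) (G \<sqinter>\<^bsub>cg_order V\<^esub> H) (Lower (cg_order V) {G, H})"
  proof (subst cg_meet_eq(2)[OF G H sub eq])
    show "greatest (cg_order V)
      (fst G \<squnion>\<^bsub>partition_order V\<^esub> fst H, P \<squnion>\<^bsub>partition_order (\<Union>P)\<^esub> Q) (Lower (cg_order V) {G, H})"
      by (rule cg_meet_eq(1)[OF G H sub eq]) (rule max)
  qed (rule max)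
  then show "G \<sqinter>\<^bsub>cg_order V\<^esub> H \<in> coloured_graphs V"
    and "cg_le V (G \<sqinter>\<^bsub>cg_order V\<^esub> H) G" "cg_le V (G \<sqinter>\<^bsub>cg_order V\<^esub> H) H"
    and "K \<in> coloured_graphs V \<Longrightarrow> cg_le V K G \<Longrightarrow> cg_le V K H \<Longrightarrow> cg_le V K (G \<sqinter>\<^bsub>cg_order V\<^esub> H)"
    using G H by (auto simp: greatest_def Lower_def cg_order_def simp del: split_paired_All)
qed

lemma cg_join:
  assumes G: "G \<in> coloured_graphs V" and H: "H \<in> coloured_graphs V"
  shows "G \<squnion>\<^bsub>cg_order V\<^esub> H \<in> coloured_graphs V"
    and "cg_le V G (G \<squnion>\<^bsub>cg_order V\<^esub> H)" "cg_le V H (G \<squnion>\<^bsub>cg_order V\<^esub> H)"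
    and "K \<in> coloured_graphs V \<Longrightarrow> cg_le V G K \<Longrightarrow> cg_le V H K \<Longrightarrow> cg_le V (G \<squnion>\<^bsub>cg_order V\<^esub> H) K"
proof -
  have "least (cg_order V) (G \<squnion>\<^bsub>cg_order V\<^esub> H) (Upper (cg_order V) {G, H})"
    unfolding cg_join_eq(2)[OF G H] by (rule cg_join_eq(1)[OF G H])
  then show "G \<squnion>\<^bsub>cg_order V\<^esub> H \<in> coloured_graphs V"
    and "cg_le V G (G \<squnion>\<^bsub>cg_order V\<^esub> H)" "cg_le V H (G \<squnion>\<^bsub>cg_order V\<^esub> H)"
    and "K \<in> coloured_graphs V \<Longrightarrow> cg_le V G K \<Longrightarrow> cg_le V H K \<Longrightarrow> cg_le V (G \<squnion>\<^bsub>cg_order V\<^esub> H) K"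
    using G H by (auto simp: least_def Upper_def cg_order_def simp del: split_paired_All)
qed

text \<open>The closure of the meet stays below both \<open>G\<close> and \<open>H\<close>, as these
  are closed, and is therefore below the meet itself.\<close>

lemma perm_generated_meet:
  assumes G: "G \<in> perm_generated_graphs V" and H: "H \<in> perm_generated_graphs V"
  shows "G \<sqinter>\<^bsub>cg_order V\<^esub> H \<in> perm_generated_graphs V"
proof -
  note c = perm_generated_coloured
  note m = cg_meet[OF c[OF G] c[OF H]]
  note s = c[OF s_perm_perm_generated(1)[OF m(1)]]
  show ?thesis
    using perm_generatedI[OF m(1)] m(4)[OF s s_perm_least[OF m(1) G m(2)] s_perm_least[OF m(1) H m(3)]] .
qed


section \<open>Inclusion of models\<close>

text \<open>A row has \<open>card V - 1\<close> off-diagonal entries of modulus at most 1, so its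
  diagonal entry exceeds their sum by at least 1. This surplus bounds the quadratic form from below
  by the sum of the squares of \<open>x\<close>.\<close>

lemma diagonally_dominant_sym_pos_def:
  fixes K :: "'a \<times> 'a \<Rightarrow> real"
  assumes V: "finite V" and K: "K \<in> V \<times> V \<rightarrow>\<^sub>E UNIV"
    and sym: "\<And>\<alpha> \<beta>. \<alpha> \<in> V \<Longrightarrow> \<beta> \<in> V \<Longrightarrow> K (\<alpha>, \<beta>) = K (\<beta>, \<alpha>)"
    and diag: "\<And>\<alpha>. \<alpha> \<in> V \<Longrightarrow> real (card V) \<le> K (\<alpha>, \<alpha>)"
    and off: "\<And>\<alpha> \<beta>. \<alpha> \<in> V \<Longrightarrow> \<beta> \<in> V \<Longrightarrow> \<alpha> \<noteq> \<beta> \<Longrightarrow> \<bar>K (\<alpha>, \<beta>)\<bar> \<le> 1"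
  shows "K \<in> sym_pos_def V"
proof -
  have "(\<Sum>\<alpha>\<in>V. \<Sum>\<beta>\<in>V. x \<alpha> * K (\<alpha>, \<beta>) * x \<beta>) > 0" if x: "a \<in> V" "x a \<noteq> 0" for x a
  proof -
    let ?n = "real (card V)"
    \<comment> \<open>Off the diagonal this is the bound from 2uv <= u^2 + v^2. The same two halves
      are subtracted on the diagonal as well, so that the double sum splits evenly; the factor
      \<open>?n + 1\<close> compensates and leaves the diagonal term \<open>?n\<close> times the
      square.\<close>
    let ?b = "\<lambda>\<alpha> \<beta>. (if \<alpha> = \<beta> then (?n + 1) * (x \<alpha>)\<^sup>2 else 0) - (x \<alpha>)\<^sup>2 / 2 - (x \<beta>)\<^sup>2 / 2"
    have term_ge: "?b \<alpha> \<beta> \<le> x \<alpha> * K (\<alpha>, \<beta>) * x \<beta>" if "\<alpha> \<in> V" "\<beta> \<in> V" for \<alpha> \<beta>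
    proof (cases "\<alpha> = \<beta>")
      case True
      have "?n * (x \<alpha>)\<^sup>2 \<le> K (\<alpha>, \<alpha>) * (x \<alpha>)\<^sup>2"
        using diag[OF that(1)] by (rule mult_right_mono) simp
      with True show ?thesis by (simp add: power2_eq_square algebra_simps)
    next
      case False
      have "\<bar>x \<alpha> * K (\<alpha>, \<beta>) * x \<beta>\<bar> = \<bar>K (\<alpha>, \<beta>)\<bar> * (\<bar>x \<alpha>\<bar> * \<bar>x \<beta>\<bar>)"
        by (simp add: abs_mult)
      also have "\<dots> \<le> 1 * (\<bar>x \<alpha>\<bar> * \<bar>x \<beta>\<bar>)"
        using off[OF that False] by (intro mult_right_mono) auto
      also have "\<dots> \<le> (x \<alpha>)\<^sup>2 / 2 + (x \<beta>)\<^sup>2 / 2"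
        using sum_squares_bound[of "\<bar>x \<alpha>\<bar>" "\<bar>x \<beta>\<bar>"] by simp
      finally show ?thesis using False by simp
    qed
    have "0 < (x a)\<^sup>2" using x by simp
    also have "\<dots> \<le> (\<Sum>\<alpha>\<in>V. (x \<alpha>)\<^sup>2)"
      by (rule member_le_sum) (use x V in auto)
    also have "\<dots> = (\<Sum>\<alpha>\<in>V. \<Sum>\<beta>\<in>V. ?b \<alpha> \<beta>)"
    proof -
      define s where "s = (\<Sum>\<alpha>\<in>V. (x \<alpha>)\<^sup>2)"
      have "(\<Sum>\<beta>\<in>V. ?b \<alpha> \<beta>) = (?n + 1) * (x \<alpha>)\<^sup>2 - ?n * ((x \<alpha>)\<^sup>2 / 2) - s / 2"
        if "\<alpha> \<in> V" for \<alpha>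
        using V that by (simp add: sum_subtractf s_def sum_divide_distrib)
      then have "(\<Sum>\<alpha>\<in>V. \<Sum>\<beta>\<in>V. ?b \<alpha> \<beta>)
        = (\<Sum>\<alpha>\<in>V. (?n + 1) * (x \<alpha>)\<^sup>2 - ?n * ((x \<alpha>)\<^sup>2 / 2) - s / 2)"
        by (rule sum.cong[OF refl])
      also have "\<dots> = (\<Sum>\<alpha>\<in>V. (?n + 1) * (x \<alpha>)\<^sup>2) - (\<Sum>\<alpha>\<in>V. ?n / 2 * (x \<alpha>)\<^sup>2) - ?n * (s / 2)"
        by (simp add: sum_subtractf)
      also have "\<dots> = (?n + 1) * s - ?n / 2 * s - ?n * (s / 2)"
        unfolding s_def sum_distrib_left ..
      also have "\<dots> = s" by (simp add: field_simps)
      finally show ?thesis by (simp add: s_def)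
    qed
    also have "\<dots> \<le> (\<Sum>\<alpha>\<in>V. \<Sum>\<beta>\<in>V. x \<alpha> * K (\<alpha>, \<beta>) * x \<beta>)"
      by (intro sum_mono term_ge)
    finally show ?thesis .
  qed
  with K sym show ?thesis by (auto simp: sym_pos_def_def)
qed

lemma rcon_modelD:
  assumes "K \<in> rcon_model V G"
  shows "\<alpha> \<in> V \<Longrightarrow> \<beta> \<in> V \<Longrightarrow> \<alpha> \<noteq> \<beta> \<Longrightarrow> {\<alpha>, \<beta>} \<notin> edges G \<Longrightarrow> K (\<alpha>, \<beta>) = 0"
    and "A \<in> fst G \<Longrightarrow> \<alpha> \<in> A \<Longrightarrow> \<beta> \<in> A \<Longrightarrow> K (\<alpha>, \<alpha>) = K (\<beta>, \<beta>)"
    and "C \<in> snd G \<Longrightarrow> {\<alpha>, \<beta>} \<in> C \<Longrightarrow> {\<gamma>, \<delta>} \<in> C \<Longrightarrow> K (\<alpha>, \<beta>) = K (\<gamma>, \<delta>)"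
    and "K \<in> sym_pos_def V"
proof -
  note K = assms[unfolded rcon_model_def mem_Collect_eq]
  note 1 = K[THEN conjunct2, THEN conjunct1]
    and 2 = K[THEN conjunct2, THEN conjunct2, THEN conjunct1]
    and 3 = K[THEN conjunct2, THEN conjunct2, THEN conjunct2]
  show "\<alpha> \<in> V \<Longrightarrow> \<beta> \<in> V \<Longrightarrow> \<alpha> \<noteq> \<beta> \<Longrightarrow> {\<alpha>, \<beta>} \<notin> edges G \<Longrightarrow> K (\<alpha>, \<beta>) = 0"
    using 1[rule_format, OF _ _ conjI, of \<alpha> \<beta>] .
  show "A \<in> fst G \<Longrightarrow> \<alpha> \<in> A \<Longrightarrow> \<beta> \<in> A \<Longrightarrow> K (\<alpha>, \<alpha>) = K (\<beta>, \<beta>)"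
    using 2[rule_format, of A \<alpha> \<beta>] .
  show "C \<in> snd G \<Longrightarrow> {\<alpha>, \<beta>} \<in> C \<Longrightarrow> {\<gamma>, \<delta>} \<in> C \<Longrightarrow> K (\<alpha>, \<beta>) = K (\<gamma>, \<delta>)"
    using 3[rule_format, OF _ conjI, of C \<alpha> \<beta> \<gamma> \<delta>] .
  show "K \<in> sym_pos_def V" by (rule K[THEN conjunct1])
qed

text \<open>The diagonal is shifted by \<open>card V\<close> to make the matrix positive definite.\<close>

definition pattern_matrix :: "'a set \<Rightarrow> 'a set \<Rightarrow> 'a set set \<Rightarrow> 'a \<times> 'a \<Rightarrow> real" where
  "pattern_matrix V A C = (\<lambda>(\<alpha>, \<beta>)\<in>V \<times> V.
     if \<alpha> = \<beta> then real (card V) + of_bool (\<alpha> \<in> A) else of_bool ({\<alpha>, \<beta>} \<in> C))"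

text \<open>The hypotheses say that \<open>A\<close> and \<open>C\<close> split no colour class, so
  the entries are constant on classes. The instances of use are the empty set, a single class and
  the whole edge set.\<close>

lemma pattern_matrix_in_model:
  assumes V: "finite V" and G: "G \<in> coloured_graphs V"
    and A: "\<And>B. B \<in> fst G \<Longrightarrow> B \<subseteq> A \<or> B \<inter> A = {}"
    and C: "C \<subseteq> edges G" "\<And>D. D \<in> snd G \<Longrightarrow> D \<subseteq> C \<or> D \<inter> C = {}"
  shows "pattern_matrix V A C \<in> rcon_model V G"
proof -
  note D = coloured_graphsD[OF G]
  have pd: "pattern_matrix V A C \<in> sym_pos_def V"
    by (rule diagonally_dominant_sym_pos_def[OF V])
      (auto simp: pattern_matrix_def insert_commute)
  have diag: "pattern_matrix V A C (\<alpha>, \<alpha>) = pattern_matrix V A C (\<beta>, \<beta>)"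
    if "B \<in> fst G" "\<alpha> \<in> B" "\<beta> \<in> B" for B \<alpha> \<beta>
  proof -
    have "\<alpha> \<in> V" "\<beta> \<in> V" using that partition_onD1[OF D(1)] by auto
    moreover have "\<alpha> \<in> A \<longleftrightarrow> \<beta> \<in> A" using that A[of B] by blast
    ultimately show ?thesis by (simp add: pattern_matrix_def)
  qed
  have entry: "pattern_matrix V A C (\<alpha>, \<beta>) = of_bool (X \<subseteq> C)" if "{\<alpha>, \<beta>} \<in> X" "X \<in> snd G" for X \<alpha> \<beta>
  proof -
    have "{\<alpha>, \<beta>} \<in> edges G" using that by (auto simp: edges_def)
    then have "{\<alpha>, \<beta>} \<in> [V]\<^bsup>2\<^esup>" using D(3) by blast
    then have "\<alpha> \<in> V" "\<beta> \<in> V" "\<alpha> \<noteq> \<beta>" by simp_all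
    moreover have "{\<alpha>, \<beta>} \<in> C \<longleftrightarrow> X \<subseteq> C" using that C(2)[of X] by blast
    ultimately show ?thesis by (simp add: pattern_matrix_def)
  qed
  have zero: "pattern_matrix V A C (\<alpha>, \<beta>) = 0"
    if "\<alpha> \<in> V" "\<beta> \<in> V" "\<alpha> \<noteq> \<beta>" "{\<alpha>, \<beta>} \<notin> edges G" for \<alpha> \<beta>
    using that C(1) by (auto simp: pattern_matrix_def)
  show ?thesis
    unfolding rcon_model_def
  proof (intro CollectI conjI ballI impI allI)
    show "pattern_matrix V A C (\<alpha>, \<beta>) = pattern_matrix V A C (\<gamma>, \<delta>)"
      if "X \<in> snd G" "{\<alpha>, \<beta>} \<in> X \<and> {\<gamma>, \<delta>} \<in> X" for X \<alpha> \<beta> \<gamma> \<delta>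
      using entry[of \<alpha> \<beta> X] entry[of \<gamma> \<delta> X] that by simp
    show "pattern_matrix V A C (\<alpha>, \<beta>) = 0"
      if "\<alpha> \<in> V" "\<beta> \<in> V" "\<alpha> \<noteq> \<beta> \<and> {\<alpha>, \<beta>} \<notin> edges G" for \<alpha> \<beta>
      using zero that by simp
  qed (fact pd, fact diag)
qed

lemma partition_class_cases:
  assumes "partition_on A P" "X \<in> P" "Y \<in> P"
  shows "X \<subseteq> Y \<or> X \<inter> Y = {}"
  using assms by (auto simp: partition_on_def disjoint_def)

text \<open>Passing from \<open>G\<close> to \<open>H\<close> refines the vertex classes and adds
  edges. The only new kind of equality constraint concerns edges absent from \<open>G\<close>, where
  the entries all vanish.\<close>

lemma rcon_model_mono:
  assumes G: "G \<in> coloured_graphs V" and H: "H \<in> coloured_graphs V" and le: "cg_le V G H"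
  shows "rcon_model V G \<subseteq> rcon_model V H"
proof
  fix K assume K: "K \<in> rcon_model V G"
  note HD = coloured_graphsD[OF H]
  have zero: "K (\<alpha>, \<beta>) = 0" if "\<alpha> \<in> V" "\<beta> \<in> V" "\<alpha> \<noteq> \<beta>" "{\<alpha>, \<beta>} \<notin> edges G" for \<alpha> \<beta>
    using rcon_modelD(1)[OF K] that .
  have diag: "K (\<alpha>, \<alpha>) = K (\<beta>, \<beta>)" if A: "A \<in> fst H" "\<alpha> \<in> A" "\<beta> \<in> A" for A \<alpha> \<beta>
  proof -
    obtain B where B: "B \<in> fst G" "A \<subseteq> B" using le A(1) by (auto simp: cg_le_def refines_def)
    then have "\<alpha> \<in> B" "\<beta> \<in> B" using A by auto
    then show ?thesis by (rule rcon_modelD(2)[OF K B(1)])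
  qed
  \<comment> \<open>A class of \<open>H\<close> that meets a class of \<open>G\<close> is one of the
    pieces forming it and inherits its constraint; a class of \<open>H\<close> that meets none
    consists of non-edges of \<open>G\<close>.\<close>
  have edge: "K (\<alpha>, \<beta>) = K (\<gamma>, \<delta>)"
    if C: "C \<in> snd H" and e: "{\<alpha>, \<beta>} \<in> C" and f: "{\<gamma>, \<delta>} \<in> C" for C \<alpha> \<beta> \<gamma> \<delta>
  proof (cases "\<exists>D\<in>snd G. C \<inter> D \<noteq> {}")
    case True
    then obtain D where D: "D \<in> snd G" "C \<inter> D \<noteq> {}" by blast
    then obtain S where S: "S \<subseteq> snd H" "D = \<Union>S"
      using le unfolding cg_le_def by meson
    then obtain X where X: "X \<in> S" "C \<inter> X \<noteq> {}" using D(2) by blast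
    then have "C = X"
      using S(1) C partition_onD2[OF HD(2)] by (auto dest: disjointD)
    with X S have "{\<alpha>, \<beta>} \<in> D" "{\<gamma>, \<delta>} \<in> D" using e f by auto
    then show ?thesis by (rule rcon_modelD(3)[OF K D(1)])
  next
    case False
    then have "{\<alpha>, \<beta>} \<notin> edges G" "{\<gamma>, \<delta>} \<notin> edges G" using e f by (auto simp: edges_def)
    moreover have "C \<subseteq> [V]\<^bsup>2\<^esup>" using C HD(3) by (auto simp: edges_def)
    then have "{\<alpha>, \<beta>} \<in> [V]\<^bsup>2\<^esup>" "{\<gamma>, \<delta>} \<in> [V]\<^bsup>2\<^esup>" using e f by (meson subsetD)+
    ultimately show ?thesis using zero by simp
  qed
  have "edges G \<subseteq> edges H" using le by (simp add: cg_le_def)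
  then show "K \<in> rcon_model V H"
    unfolding rcon_model_def
  proof (intro CollectI conjI ballI impI allI)
    show "K (\<alpha>, \<beta>) = K (\<gamma>, \<delta>)"
      if "C \<in> snd H" "{\<alpha>, \<beta>} \<in> C \<and> {\<gamma>, \<delta>} \<in> C" for C \<alpha> \<beta> \<gamma> \<delta>
      using edge[of C] that by blast
    show "K (\<alpha>, \<beta>) = 0" if "edges G \<subseteq> edges H" "\<alpha> \<in> V" "\<beta> \<in> V" "\<alpha> \<noteq> \<beta> \<and> {\<alpha>, \<beta>} \<notin> edges H" for \<alpha> \<beta>
      using that zero[of \<alpha> \<beta>] by auto
    show "K \<in> sym_pos_def V"
      by (rule rcon_modelD(4)[OF K])
  qed (rule diag)
qed

text \<open>Each clause of \<open>cg_le\<close> is forced by its own test matrix from the model of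
  \<open>G\<close>: the indicator of all edges gives the edge inclusion, a raised diagonal on one
  vertex class gives the refinement, and the indicator of one edge class shows that \<open>H\<close>
  does not cut across it.\<close>

lemma rcon_model_reflects:
  assumes V: "finite V" and G: "G \<in> coloured_graphs V" and H: "H \<in> coloured_graphs V"
    and le: "rcon_model V G \<subseteq> rcon_model V H"
  shows "cg_le V G H"
proof -
  note GD = coloured_graphsD[OF G] and HD = coloured_graphsD[OF H]
  have E: "edges G \<subseteq> edges H"
  proof
    fix e assume e: "e \<in> edges G"
    then obtain \<alpha> \<beta> where ab: "e = {\<alpha>, \<beta>}" "\<alpha> \<in> V" "\<beta> \<in> V" "\<alpha> \<noteq> \<beta>"
      using nsets2_E[OF subsetD[OF GD(3)]] by metis
    have m: "pattern_matrix V {} (edges G) \<in> rcon_model V H"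
      by (rule subsetD[OF le pattern_matrix_in_model[OF V G]]) (auto simp: edges_def)
    have "pattern_matrix V {} (edges G) (\<alpha>, \<beta>) \<noteq> 0"
      using ab e by (simp add: pattern_matrix_def)
    then show "e \<in> edges H" using ab(1) rcon_modelD(1)[OF m ab(2-4)] by blast
  qed
  have "\<exists>Y\<in>fst G. X \<subseteq> Y" if X: "X \<in> fst H" for X
  proof -
    have "X \<noteq> {}" "X \<subseteq> V" using X HD(1) by (auto simp: partition_on_def)
    then obtain x where x: "x \<in> X" by blast
    then obtain Y where Y: "Y \<in> fst G" "x \<in> Y"
      using \<open>X \<subseteq> V\<close> partition_onD1[OF GD(1)] by blast
    have m: "pattern_matrix V Y {} \<in> rcon_model V H"
      by (rule subsetD[OF le pattern_matrix_in_model[OF V G partition_class_cases[OF GD(1) _ Y(1)]]]) auto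
    have eq: "pattern_matrix V Y {} (x, x) = pattern_matrix V Y {} (y, y)" if "y \<in> X" for y
      using rcon_modelD(2)[OF m X x that] .
    have "y \<in> Y" if y: "y \<in> X" for y
    proof -
      have "x \<in> V" "y \<in> V" using x y \<open>X \<subseteq> V\<close> by auto
      then have "of_bool (x \<in> Y) = (of_bool (y \<in> Y) :: real)"
        using eq[OF y] by (simp add: pattern_matrix_def)
      with Y(2) show ?thesis by (simp split: if_splits)
    qed
    with Y(1) show ?thesis by blast
  qed
  with GD(1) HD(1) have "refines V (fst H) (fst G)" by (simp add: refines_def)
  moreover have "\<exists>S\<subseteq>snd H. C = \<Union>S" if C: "C \<in> snd G" for C
  proof -
    have CE: "C \<subseteq> edges G" using C by (auto simp: edges_def)
    have m: "pattern_matrix V {} C \<in> rcon_model V H"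
      by (rule subsetD[OF le pattern_matrix_in_model[OF V G _ CE partition_class_cases[OF GD(2) _ C]]]) auto
    \<comment> \<open>The matrix is constant on a class of \<open>H\<close>, so a single entry 1 in
      it, at \<open>e\<close>, forces the value 1, and hence membership in \<open>C\<close>,
      throughout.\<close>
    have sub: "D \<subseteq> C" if D: "D \<in> snd H" "e \<in> D" "e \<in> C" for D e
    proof
      fix f assume f: "f \<in> D"
      have "D \<subseteq> [V]\<^bsup>2\<^esup>" using D(1) HD(3) by (auto simp: edges_def)
      then have "e \<in> [V]\<^bsup>2\<^esup>" "f \<in> [V]\<^bsup>2\<^esup>" using D(2) f by auto
      then obtain \<alpha> \<beta> \<gamma> \<delta> where ef: "e = {\<alpha>, \<beta>}" "\<alpha> \<in> V" "\<beta> \<in> V" "\<alpha> \<noteq> \<beta>"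
        "f = {\<gamma>, \<delta>}" "\<gamma> \<in> V" "\<delta> \<in> V" "\<gamma> \<noteq> \<delta>"
        using nsets2_E by metis
      have "pattern_matrix V {} C (\<alpha>, \<beta>) = pattern_matrix V {} C (\<gamma>, \<delta>)"
        using D(2) f unfolding ef by (rule rcon_modelD(3)[OF m D(1)])
      then have "of_bool (e \<in> C) = (of_bool (f \<in> C) :: real)"
        using ef by (simp add: pattern_matrix_def)
      then show "f \<in> C" using D(3) by (simp split: if_splits)
    qed
    have "C \<subseteq> \<Union>{D \<in> snd H. D \<subseteq> C}"
    proof
      fix e assume e: "e \<in> C"
      then have "e \<in> \<Union>(snd H)" using CE E by (auto simp: edges_def)
      then obtain D where "D \<in> snd H" "e \<in> D" by blast
      with sub e show "e \<in> \<Union>{D \<in> snd H. D \<subseteq> C}" by blast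
    qed
    then show ?thesis by (intro exI[of _ "{D \<in> snd H. D \<subseteq> C}"]) blast
  qed
  ultimately show ?thesis using E by (simp add: cg_le_def)
qed

section \<open>Graphs without edges\<close>

lemma edges_empty: "edges (P, {}) = {}"
  by (simp add: edges_def)

lemma coloured_graph_empty: "partition_on V P \<Longrightarrow> (P, {}) \<in> coloured_graphs V"
  by (rule coloured_graphsI[of _ _ "{}"]) (simp_all add: partition_on_def)

lemma empty_cg_le_iff: "cg_le V (P, {}) K \<longleftrightarrow> refines V (fst K) P"
  by (simp add: cg_le_def edges_empty)

lemma cg_le_empty_iff:
  assumes "M \<in> coloured_graphs V"
  shows "cg_le V M (P, {}) \<longleftrightarrow> edges M = {} \<and> refines V P (fst M)"
proof -
  have "snd M = {}" if "edges M = {}"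
    using that coloured_graphsD(2)[OF assms] by (auto simp: partition_on_def edges_def)
  then show ?thesis by (auto simp: cg_le_def edges_empty)
qed

text \<open>The transposition maps onto itself every set containing both points or neither, and each
  class of \<open>P\<close> is of this kind. It is restricted to \<open>V\<close> because elements
  of \<open>BijGroup V\<close> are extensional.\<close>

lemma swap_in_cg_aut:
  assumes P: "partition_on V P" and X: "X \<in> P" "x \<in> X" "y \<in> X"
  defines "g \<equiv> \<lambda>v\<in>V. if v = x then y else if v = y then x else v"
  shows "g \<in> cg_aut V (P, {})"
proof -
  have xy: "x \<in> V" "y \<in> V" using X partition_onD1[OF P] by auto
  have inv: "g (g v) = v" if "v \<in> V" for v
    using that xy by (simp add: g_def)
  have stable: "g ` Z = Z" if Z: "Z \<subseteq> V" "x \<in> Z \<longleftrightarrow> y \<in> Z" for Z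
  proof
    show sub: "g ` Z \<subseteq> Z" using Z by (auto simp: g_def)
    show "Z \<subseteq> g ` Z"
    proof
      fix v assume v: "v \<in> Z"
      then have "v = g (g v)" "g v \<in> Z" using inv Z(1) sub by auto
      then show "v \<in> g ` Z" by (rule image_eqI)
    qed
  qed
  have "bij_betw g V V"
    by (rule bij_betw_byWitness[where f' = g]) (use inv stable[of V] xy in auto)
  moreover have "g ` Z = Z" if Z: "Z \<in> P" for Z
  proof (rule stable)
    show "Z \<subseteq> V" using Z partition_onD1[OF P] by auto
    show "x \<in> Z \<longleftrightarrow> y \<in> Z"
      using partition_class_cases[OF P X(1) Z] X(2,3) by auto
  qed
  moreover have "g \<in> extensional V" by (simp add: g_def)
  ultimately show ?thesis by (simp add: cg_aut_def carrier_BijGroup)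
qed

text \<open>Transpositions within a class make it a single orbit, as no edge restricts them. So all
  vertex partitions are available for the counterexample to distributivity.\<close>

lemma empty_graph_perm_generated:
  assumes P: "partition_on V P"
  shows "(P, {}) \<in> perm_generated_graphs V"
proof -
  note F = coloured_graph_empty[OF P]
  note s = s_perm_perm_generated[OF F]
  note sD = coloured_graphsD[OF perm_generated_coloured[OF s(1)]]
  have "\<exists>Y\<in>fst (s_perm V (P, {})). X \<subseteq> Y" if X: "X \<in> P" for X
  proof -
    obtain x where x: "x \<in> X" using X partition_onD3[OF P] by (metis all_not_in_conv)
    let ?Y = "orbit (BijGroup V\<lparr>carrier := cg_aut V (P, {})\<rparr>) (\<lambda>g \<alpha>. g \<alpha>) x"
    have XV: "X \<subseteq> V" using X partition_onD1[OF P] by auto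
    have "?Y \<in> fst (s_perm V (P, {}))"
      using x XV by (auto simp: s_perm_def orbit_colouring_def orbits_def)
    moreover have "X \<subseteq> ?Y"
    proof
      fix y assume y: "y \<in> X"
      let ?g = "\<lambda>v\<in>V. if v = x then y else if v = y then x else v"
      have "y = ?g x" using x XV by auto
      with swap_in_cg_aut[OF P X x y] show "y \<in> ?Y" unfolding orbit_def by (intro CollectI exI[of _ ?g]) simp
    qed
    ultimately show ?thesis by blast
  qed
  then have "refines V P (fst (s_perm V (P, {})))"
    using P sD(1) by (simp add: refines_def)
  then have "cg_le V (s_perm V (P, {})) (P, {})"
    using cg_le_empty_iff[OF perm_generated_coloured[OF s(1)]] s(2) by (simp add: edges_empty)
  with F show ?thesis by (rule perm_generatedI)
qed

text \<open>For distinct \<open>x\<close> and \<open>y\<close> in \<open>V\<close> this is an atom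
  of the partitions of \<open>V\<close> under refinement.\<close>

definition pair_partition :: "'a set \<Rightarrow> 'a \<Rightarrow> 'a \<Rightarrow> 'a set set" where
  "pair_partition V x y = insert {x, y} ((\<lambda>v. {v}) ` (V - {x, y}))"

lemma pair_partition:
  assumes "x \<in> V" "y \<in> V"
  shows "partition_on V (pair_partition V x y)"
  using assms by (auto simp: partition_on_def disjoint_def pair_partition_def)

lemma pair_partition_refines_iff:
  assumes xy: "x \<in> V" "y \<in> V" and Q: "partition_on V Q"
  shows "refines V (pair_partition V x y) Q \<longleftrightarrow> (\<exists>Y\<in>Q. x \<in> Y \<and> y \<in> Y)"
proof -
  have "\<exists>Y\<in>Q. {v} \<subseteq> Y" if "v \<in> V" for v
    using that partition_onD1[OF Q] by auto
  then show ?thesis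
    using Q pair_partition[OF xy] by (auto simp: refines_def pair_partition_def)
qed

lemma pair_partition_class_subset:
  assumes "refines V Q (pair_partition V x y)" "X \<in> Q"
  obtains "X \<subseteq> {x, y}" | v where "X \<subseteq> {v}"
  using assms by (auto simp: refines_def pair_partition_def)

lemma partition_on_singletons: "partition_on V ((\<lambda>v. {v}) ` V)"
  by (auto simp: partition_on_def disjoint_def)

section \<open>The lattice of models\<close>

lemma perm_model_order_simps:
  "X \<sqsubseteq>\<^bsub>perm_model_order V\<^esub> Y \<longleftrightarrow> X \<subseteq> Y"
  "carrier (perm_model_order V) = rcon_model V ` perm_generated_graphs V"
  by (simp_all add: perm_model_order_def)

lemma partial_order_perm_model_order: "partial_order (perm_model_order V)"
  by unfold_locales (auto simp: perm_model_order_def)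

text \<open>Order reflection turns a model below both given models into a coloured graph below
  \<open>G\<close> and \<open>H\<close>, to which the meet property in \<open>cg_order V\<close>
  applies.\<close>

lemma perm_model_greatest:
  assumes V: "finite V" and G: "G \<in> perm_generated_graphs V" and H: "H \<in> perm_generated_graphs V"
  shows "greatest (perm_model_order V) (rcon_model V (G \<sqinter>\<^bsub>cg_order V\<^esub> H))
    (Lower (perm_model_order V) {rcon_model V G, rcon_model V H})"
proof -
  let ?M = "G \<sqinter>\<^bsub>cg_order V\<^esub> H"
  note c = perm_generated_coloured
  note m = cg_meet[OF c[OF G] c[OF H]] and M = perm_generated_meet[OF G H]
  have lower: "rcon_model V ?M \<subseteq> rcon_model V G" "rcon_model V ?M \<subseteq> rcon_model V H"
    using rcon_model_mono[OF m(1) c[OF G] m(2)] rcon_model_mono[OF m(1) c[OF H] m(3)] by simp_all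
  have greatest: "rcon_model V K \<subseteq> rcon_model V ?M"
    if K: "K \<in> perm_generated_graphs V"
      and le: "rcon_model V K \<subseteq> rcon_model V G" "rcon_model V K \<subseteq> rcon_model V H" for K
    by (rule rcon_model_mono[OF c[OF K] m(1) m(4)[OF c[OF K]
            rcon_model_reflects[OF V c[OF K] c[OF G] le(1)] rcon_model_reflects[OF V c[OF K] c[OF H] le(2)]]])
  show ?thesis
  proof (rule greatest_LowerI)
    fix Y assume "Y \<in> Lower (perm_model_order V) {rcon_model V G, rcon_model V H}"
    then obtain K where "K \<in> perm_generated_graphs V" "Y = rcon_model V K"
      "Y \<subseteq> rcon_model V G" "Y \<subseteq> rcon_model V H"
      using G H by (auto simp: Lower_def perm_model_order_simps)
    then show "Y \<sqsubseteq>\<^bsub>perm_model_order V\<^esub> rcon_model V ?M"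
      using greatest[of K] by (simp add: perm_model_order_simps)
  qed (use lower M G H in \<open>auto simp: perm_model_order_simps\<close>)
qed

text \<open>An upper bound \<open>K\<close> is reflected to a coloured graph above the join in
  \<open>cg_order V\<close>; as \<open>K\<close> is permutation-generated, it is also above the
  closure of that join.\<close>

lemma perm_model_least:
  assumes V: "finite V" and G: "G \<in> perm_generated_graphs V" and H: "H \<in> perm_generated_graphs V"
  shows "least (perm_model_order V) (rcon_model V (s_perm V (G \<squnion>\<^bsub>cg_order V\<^esub> H)))
    (Upper (perm_model_order V) {rcon_model V G, rcon_model V H})"
proof -
  let ?J = "G \<squnion>\<^bsub>cg_order V\<^esub> H"
  let ?M = "s_perm V ?J"
  note c = perm_generated_coloured
  note j = cg_join[OF c[OF G] c[OF H]]
  note M = s_perm_perm_generated(1)[OF j(1)] and up = s_perm_above[OF j(1)]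
  have "cg_le V G ?M" "cg_le V H ?M"
    using cg_le_trans[OF _ up c[OF G] j(1) c[OF M]] cg_le_trans[OF _ up c[OF H] j(1) c[OF M]] j(2,3)
    by simp_all
  then have upper: "rcon_model V G \<subseteq> rcon_model V ?M" "rcon_model V H \<subseteq> rcon_model V ?M"
    using rcon_model_mono[OF c[OF G] c[OF M]] rcon_model_mono[OF c[OF H] c[OF M]] by simp_all
  have least: "rcon_model V ?M \<subseteq> rcon_model V K"
    if K: "K \<in> perm_generated_graphs V"
      and le: "rcon_model V G \<subseteq> rcon_model V K" "rcon_model V H \<subseteq> rcon_model V K" for K
    by (rule rcon_model_mono[OF c[OF M] c[OF K] s_perm_least[OF j(1) K j(4)[OF c[OF K]
            rcon_model_reflects[OF V c[OF G] c[OF K] le(1)] rcon_model_reflects[OF V c[OF H] c[OF K] le(2)]]]])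
  show ?thesis
  proof (rule least_UpperI)
    fix Y assume "Y \<in> Upper (perm_model_order V) {rcon_model V G, rcon_model V H}"
    then obtain K where "K \<in> perm_generated_graphs V" "Y = rcon_model V K"
      "rcon_model V G \<subseteq> Y" "rcon_model V H \<subseteq> Y"
      using G H by (auto simp: Upper_def perm_model_order_simps)
    then show "rcon_model V ?M \<sqsubseteq>\<^bsub>perm_model_order V\<^esub> Y"
      using least[of K] by (simp add: perm_model_order_simps)
  qed (use upper M G H in \<open>auto simp: perm_model_order_simps\<close>)
qed

lemma lattice_perm_model_order:
  assumes "finite V"
  shows "lattice (perm_model_order V)"
proof -
  interpret partial_order "perm_model_order V" by (rule partial_order_perm_model_order)
  have graph: "\<exists>G\<in>perm_generated_graphs V. x = rcon_model V G"
    if "x \<in> carrier (perm_model_order V)" for x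
    using that by (auto simp: perm_model_order_def)
  show ?thesis
  proof
    show "\<exists>s. least (perm_model_order V) s (Upper (perm_model_order V) {x, y})"
      if "x \<in> carrier (perm_model_order V)" "y \<in> carrier (perm_model_order V)" for x y
      using graph[OF that(1)] graph[OF that(2)] perm_model_least[OF assms] by metis
    show "\<exists>s. greatest (perm_model_order V) s (Lower (perm_model_order V) {x, y})"
      if "x \<in> carrier (perm_model_order V)" "y \<in> carrier (perm_model_order V)" for x y
      using graph[OF that(1)] graph[OF that(2)] perm_model_greatest[OF assms] by metis
  qed
qed

lemma perm_model_meet:
  assumes "finite V" "G \<in> perm_generated_graphs V" "H \<in> perm_generated_graphs V"
  shows "rcon_model V G \<sqinter>\<^bsub>perm_model_order V\<^esub> rcon_model V H = rcon_model V (G \<sqinter>\<^bsub>cg_order V\<^esub> H)"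
proof -
  interpret lattice "perm_model_order V" using assms(1) by (rule lattice_perm_model_order)
  have "rcon_model V G \<in> carrier (perm_model_order V)" "rcon_model V H \<in> carrier (perm_model_order V)"
    using assms by (auto simp: perm_model_order_def)
  from greatest_unique[OF inf_of_two_greatest[OF this] perm_model_greatest[OF assms]]
  show ?thesis by (simp only: meet_def)
qed

lemma perm_model_join:
  assumes "finite V" "G \<in> perm_generated_graphs V" "H \<in> perm_generated_graphs V"
  shows "rcon_model V G \<squnion>\<^bsub>perm_model_order V\<^esub> rcon_model V H
    = rcon_model V (s_perm V (G \<squnion>\<^bsub>cg_order V\<^esub> H))"
proof -
  interpret lattice "perm_model_order V" using assms(1) by (rule lattice_perm_model_order)
  have "rcon_model V G \<in> carrier (perm_model_order V)" "rcon_model V H \<in> carrier (perm_model_order V)"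
    using assms by (auto simp: perm_model_order_def)
  from least_unique[OF sup_of_two_least[OF this] perm_model_least[OF assms]]
  show ?thesis by (simp only: join_def)
qed

section \<open>Completeness from finiteness and a top element\<close>

lemma finite_coloured_graphs:
  assumes "finite V"
  shows "finite (coloured_graphs V)"
proof (rule finite_subset)
  show "coloured_graphs V \<subseteq> Pow (Pow V) \<times> Pow (Pow (Pow V))"
  proof
    fix G assume "G \<in> coloured_graphs V"
    note D = coloured_graphsD[OF this]
    have "\<Union>(snd G) \<subseteq> Pow V" using D(3) by (auto simp: edges_def nsets_def)
    then have "fst G \<subseteq> Pow V" "snd G \<subseteq> Pow (Pow V)"
      using partition_onD1[OF D(1)] by auto
    then show "G \<in> Pow (Pow V) \<times> Pow (Pow (Pow V))" by (simp add: mem_Times_iff)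
  qed
qed (use assms in simp)

text \<open>The complete graph with only singleton classes imposes no constraint beyond symmetry and
  positive definiteness; it provides the top element.\<close>

lemma discrete_graph_above:
  assumes G: "G \<in> coloured_graphs V"
  defines "T \<equiv> ((\<lambda>v. {v}) ` V, (\<lambda>e. {e}) ` [V]\<^bsup>2\<^esup>)"
  shows "T \<in> coloured_graphs V" "cg_le V G T"
proof -
  note D = coloured_graphsD[OF G]
  show "T \<in> coloured_graphs V"
    unfolding T_def
    by (rule coloured_graphsI[OF partition_on_singletons partition_on_singletons]) simp
  have "refines V (fst T) (fst G)"
    using D(1) partition_on_singletons[of V] partition_onD1[OF D(1)] by (auto simp: T_def refines_def)
  moreover have "\<exists>S\<subseteq>snd T. C = \<Union>S" if "C \<in> snd G" for C
    using that D(3) by (intro exI[of _ "(\<lambda>e. {e}) ` C"]) (auto simp: T_def edges_def)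
  moreover have "edges G \<subseteq> edges T" using D(3) by (auto simp: T_def edges_def)
  ultimately show "cg_le V G T" by (simp add: cg_le_def)
qed

text \<open>The carrier is finite, so binary infima yield infima of all nonempty subsets, and the
  completeness criterion then asks only for a greatest element.\<close>

lemma complete_lattice_perm_model_order:
  assumes V: "finite V"
  shows "complete_lattice (perm_model_order V)"
proof -
  interpret lattice "perm_model_order V" using V by (rule lattice_perm_model_order)
  note c = perm_generated_coloured
  have fin: "finite (carrier (perm_model_order V))"
    unfolding perm_model_order_simps
    by (intro finite_imageI finite_subset[OF subsetI[OF c] finite_coloured_graphs[OF V]])
  show ?thesis
  proof (rule complete_lattice_criterion1)
    let ?T = "((\<lambda>v. {v}) ` V, (\<lambda>e. {e}) ` [V]\<^bsup>2\<^esup>)"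
    have T: "?T \<in> perm_generated_graphs V"
    proof (rule perm_generatedI)
      show "?T \<in> coloured_graphs V"
        by (rule discrete_graph_above(1)[OF coloured_graph_empty[OF partition_on_singletons]])
      \<comment> \<open>Every coloured graph lies below \<open>?T\<close>, its own closure
        included.\<close>
      then show "cg_le V (s_perm V ?T) ?T"
        by (rule discrete_graph_above(2)[OF c[OF s_perm_perm_generated(1)]])
    qed
    have "rcon_model V G \<subseteq> rcon_model V ?T" if "G \<in> perm_generated_graphs V" for G
      using that by (intro rcon_model_mono c T discrete_graph_above)
    with T show "\<exists>g. greatest (perm_model_order V) g (carrier (perm_model_order V))"
      by (intro exI[of _ "rcon_model V ?T"]) (simp add: greatest_def perm_model_order_def)
    show "\<exists>i. greatest (perm_model_order V) i (Lower (perm_model_order V) A)"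
      if "A \<subseteq> carrier (perm_model_order V)" "A \<noteq> {}" for A
      using finite_inf_greatest[OF finite_subset[OF that(1) fin] that] by blast
  qed
qed

text \<open>
  The edgeless graphs that identify exactly one of the pairs \<open>xy\<close>, \<open>xz\<close>, \<open>yz\<close> are the atoms of a
  diamond \<open>M\<^sub>3\<close>, bounded by the one identifying all of \<open>x\<close>, \<open>y\<close>, \<open>z\<close> and the discrete one.
\<close>

lemma not_distributive_perm_model_order:
  assumes V: "finite V" "card V \<ge> 3"
  shows "\<not> distributive (perm_model_order V)"
proof
  assume dist: "distributive (perm_model_order V)"
  obtain x y z where xyz: "x \<in> V" "y \<in> V" "z \<in> V" "x \<noteq> y" "x \<noteq> z" "y \<noteq> z"
  proof -
    obtain W where "W \<subseteq> V" "card W = 3" using obtain_subset_with_card_n[OF V(2)] by metis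
    then show thesis using that by (auto simp: card_3_iff)
  qed
  define A B C D where "A = (pair_partition V x y, {} :: 'a set set set)"
    and "B = (pair_partition V x z, {} :: 'a set set set)"
    and "C = (pair_partition V y z, {} :: 'a set set set)"
    and "D = ((\<lambda>v. {v}) ` V, {} :: 'a set set set)"
  note c = perm_generated_coloured
  have ABCD: "A \<in> perm_generated_graphs V" "B \<in> perm_generated_graphs V"
    "C \<in> perm_generated_graphs V" "D \<in> perm_generated_graphs V"
    unfolding A_def B_def C_def D_def
    by (intro empty_graph_perm_generated pair_partition partition_on_singletons xyz)+
  interpret lattice "perm_model_order V" using V(1) by (rule lattice_perm_model_order)
  let ?a = "rcon_model V A" and ?b = "rcon_model V B" and ?c = "rcon_model V C"
    and ?d = "rcon_model V D"
  have carr: "?a \<in> carrier (perm_model_order V)" "?b \<in> carrier (perm_model_order V)"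
    "?c \<in> carrier (perm_model_order V)" "?d \<in> carrier (perm_model_order V)"
    using ABCD by (simp_all add: perm_model_order_def)
  note le = perm_model_order_simps(1)

  \<comment> \<open>A meet coarsens the vertex partition: joining \<open>x\<close> with
    \<open>z\<close> and \<open>y\<close> with \<open>z\<close> also joins \<open>x\<close> with
    \<open>y\<close>, which is the only merger that \<open>A\<close> makes.\<close>
  have "rcon_model V (B \<sqinter>\<^bsub>cg_order V\<^esub> C) \<subseteq> ?a"
  proof -
    let ?M = "B \<sqinter>\<^bsub>cg_order V\<^esub> C"
    note m = cg_meet[OF c[OF ABCD(2)] c[OF ABCD(3)]]
    note P = coloured_graphsD(1)[OF m(1)]
    have e: "edges ?M = {}" and r: "refines V (pair_partition V x z) (fst ?M)"
      "refines V (pair_partition V y z) (fst ?M)"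
      using m(2,3) cg_le_empty_iff[OF m(1)] by (simp_all add: B_def C_def)
    obtain Y where Y: "Y \<in> fst ?M" "x \<in> Y" "z \<in> Y"
      using r(1) pair_partition_refines_iff[OF xyz(1,3) P] by blast
    obtain Z where Z: "Z \<in> fst ?M" "y \<in> Z" "z \<in> Z"
      using r(2) pair_partition_refines_iff[OF xyz(2,3) P] by blast
    have "Y = Z" using Y Z partition_onD2[OF P] by (metis disjointD disjoint_iff)
    then have "refines V (pair_partition V x y) (fst ?M)"
      using Y Z pair_partition_refines_iff[OF xyz(1,2) P] by blast
    with e have "cg_le V ?M A" using cg_le_empty_iff[OF m(1)] by (simp add: A_def)
    then show ?thesis by (rule rcon_model_mono[OF m(1) c[OF ABCD(1)]])
  qed
  then have bc: "?b \<sqinter>\<^bsub>perm_model_order V\<^esub> ?c \<subseteq> ?a"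
    using perm_model_meet[OF V(1) ABCD(2,3)] by simp
  \<comment> \<open>The left side of the distributive law collapses to \<open>?a\<close>; the rest
    shows that the right side is too large for that.\<close>
  have "?a \<squnion>\<^bsub>perm_model_order V\<^esub> (?b \<sqinter>\<^bsub>perm_model_order V\<^esub> ?c) \<subseteq> ?a"
    using join_le[of ?a ?a "?b \<sqinter>\<^bsub>perm_model_order V\<^esub> ?c"] bc carr by (simp add: le)
  moreover have "?a \<squnion>\<^bsub>perm_model_order V\<^esub> (?b \<sqinter>\<^bsub>perm_model_order V\<^esub> ?c)
    = (?a \<squnion>\<^bsub>perm_model_order V\<^esub> ?b) \<sqinter>\<^bsub>perm_model_order V\<^esub> (?a \<squnion>\<^bsub>perm_model_order V\<^esub> ?c)"
    using dist carr(1-3) unfolding distributive_def by blast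
  ultimately have meet: "(?a \<squnion>\<^bsub>perm_model_order V\<^esub> ?b) \<sqinter>\<^bsub>perm_model_order V\<^esub> (?a \<squnion>\<^bsub>perm_model_order V\<^esub> ?c) \<subseteq> ?a"
    by simp

  have discrete: "?d \<subseteq> rcon_model V (pair_partition V x y, {}) \<squnion>\<^bsub>perm_model_order V\<^esub> rcon_model V H"
    if H: "H \<in> perm_generated_graphs V" "H = (pair_partition V u z, {})" and u: "u = x \<or> u = y" for H u
  proof -
    let ?J = "rcon_model V A \<squnion>\<^bsub>perm_model_order V\<^esub> rcon_model V H"
    have h: "rcon_model V H \<in> carrier (perm_model_order V)"
      using H by (simp add: perm_model_order_def)
    \<comment> \<open>Any graph representing the join will do, since only its lying above both
      \<open>A\<close> and \<open>H\<close> matters; the formula with \<open>s_perm\<close> can be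
      avoided.\<close>
    obtain K where K: "K \<in> perm_generated_graphs V" "?J = rcon_model V K"
      using join_closed[OF carr(1) h] by (auto simp: perm_model_order_def)
    have "?a \<subseteq> rcon_model V K" "rcon_model V H \<subseteq> rcon_model V K"
      using join_left[OF carr(1) h] join_right[OF carr(1) h] K(2) by (simp_all add: le)
    then have "cg_le V A K" "cg_le V H K"
      using rcon_model_reflects[OF V(1) _ c[OF K(1)]] c[OF ABCD(1)] c[OF H(1)] by simp_all
    then have r: "refines V (fst K) (pair_partition V x y)" "refines V (fst K) (pair_partition V u z)"
      by (simp_all add: A_def H(2) empty_cg_le_iff)
    note P = coloured_graphsD(1)[OF c[OF K(1)]]
    have "\<exists>Y\<in>(\<lambda>v. {v}) ` V. X \<subseteq> Y" if X: "X \<in> fst K" for X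
    proof -
      \<comment> \<open>The two pairs {x, y} and {u, z} share only \<open>u\<close>, so a class
        fitting into both partitions has at most one point.\<close>
      have "\<exists>v. X \<subseteq> {v}"
      proof (rule pair_partition_class_subset[OF r(1) X])
        assume X1: "X \<subseteq> {x, y}"
        show ?thesis
        proof (rule pair_partition_class_subset[OF r(2) X])
          assume "X \<subseteq> {u, z}"
          with X1 u xyz have "X \<subseteq> {u}" by auto
          then show ?thesis ..
        qed blast
      qed blast
      moreover have "X \<noteq> {}" "X \<subseteq> V" using X P by (auto simp: partition_on_def)
      ultimately show ?thesis by blast
    qed
    then have "refines V (fst K) ((\<lambda>v. {v}) ` V)"
      using P partition_on_singletons[of V] by (simp add: refines_def)
    then have "cg_le V D K" by (simp add: D_def empty_cg_le_iff)
    then show ?thesis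
      using rcon_model_mono[OF c[OF ABCD(4)] c[OF K(1)]] K(2) by (simp add: A_def)
  qed
  have "?d \<subseteq> ?a \<squnion>\<^bsub>perm_model_order V\<^esub> ?b" "?d \<subseteq> ?a \<squnion>\<^bsub>perm_model_order V\<^esub> ?c"
    using discrete[OF ABCD(2), of x] discrete[OF ABCD(3), of y] by (simp_all add: A_def B_def C_def)
  then have "?d \<subseteq> (?a \<squnion>\<^bsub>perm_model_order V\<^esub> ?b) \<sqinter>\<^bsub>perm_model_order V\<^esub> (?a \<squnion>\<^bsub>perm_model_order V\<^esub> ?c)"
    using meet_le[of ?d "?a \<squnion>\<^bsub>perm_model_order V\<^esub> ?b" "?a \<squnion>\<^bsub>perm_model_order V\<^esub> ?c"] carr
    by (simp add: le)
  with meet have "?d \<subseteq> ?a" by blast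
  \<comment> \<open>This is impossible: it would place the class {x, y} of \<open>A\<close> inside a
    singleton.\<close>
  then have "cg_le V D A"
    by (rule rcon_model_reflects[OF V(1) c[OF ABCD(4)] c[OF ABCD(1)]])
  then have "refines V (pair_partition V x y) ((\<lambda>v. {v}) ` V)"
    by (simp add: A_def D_def empty_cg_le_iff)
  with xyz(4) show False by (auto simp: refines_def pair_partition_def)
qed

text \<open>The bound on \<open>card V\<close> is sharp. On two vertices the four models, with equal
  or free diagonal entries and with or without the edge, form a Boolean lattice, which is
  distributive; on fewer vertices there is only one model.\<close>

theorem theorem5p6:
  fixes V :: "'a set"
  assumes "finite V"
  shows "complete_lattice (perm_model_order V) \<and>
    (card V \<ge> 3 \<longrightarrow> \<not> distributive (perm_model_order V)) \<and>
    (\<forall>G\<in>perm_generated_graphs V. \<forall>H\<in>perm_generated_graphs V.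
       G \<sqinter>\<^bsub>cg_order V\<^esub> H \<in> perm_generated_graphs V \<and>
       rcon_model V G \<sqinter>\<^bsub>perm_model_order V\<^esub> rcon_model V H
         = rcon_model V (G \<sqinter>\<^bsub>cg_order V\<^esub> H)) \<and>
    (\<forall>G\<in>perm_generated_graphs V. \<forall>H\<in>perm_generated_graphs V.
       rcon_model V G \<squnion>\<^bsub>perm_model_order V\<^esub> rcon_model V H
         = rcon_model V (s_perm V (G \<squnion>\<^bsub>cg_order V\<^esub> H)))"
  using complete_lattice_perm_model_order[OF assms] not_distributive_perm_model_order[OF assms]
    perm_generated_meet perm_model_meet[OF assms] perm_model_join[OF assms]
  by (intro conjI ballI impI)

end
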